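(* Let $1<p\le 2\le q<\infty$ with $p<q$. If $R\in L(\ell_p,\ell_q)$ is not finitely strictly singular, then every Pełczyński Decomposition operator $T\colon\ell_p\to\ell_q$ factors through $R$, i.e. $T=ARB$ for some $A\in L(\ell_q)$ and $B\in L(\ell_p)$.
   Context: $L(X,Y)$ is the space of bounded linear operators from $X$ to $Y$, and $L(X)=L(X,X)$. An operator $S\colon X\to Y$ is finitely strictly singular (FSS) if for every $\varepsilon>0$ there is $n\in\mathbb N$ such that $\inf_{x\in E,\|x\|=1}\|Sx\|<\varepsilon$ for every $n$-dimensional subspace $E$ of $X$. For $1<r<\infty$, $\bigl(\bigoplus_{n=1}^\infty\ell_2^n\bigr)_r$ denotes the $\ell_r$-direct sum of the $\ell_2^n$; it is known to be isomorphic to $\ell_r$. Let $I_{2,p,q}\colon\bigl(\bigoplus_{n}\ell_2^n\bigr)_p\to\bigl(\bigoplus_{n}\ell_2^n\bigr)_q$ be the formal identity. A Pełczyński Decomposition operator is any operator $T=V I_{2,p,q}U\colon\ell_p\to\ell_q$, where $U\colon\ell_p\to\bigl(\bigoplus_{n}\ell_2^n\bigr)_p$ and $V\colon\bigl(\bigoplus_{n}\ell_2^n\bigr)_q\to\ell_q$ are (surjective) isomorphisms. *)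

theory Defs
  imports "HOL-Analysis.Analysis" "HOL-Library.Function_Algebras"
begin

text \<open>
  The exponents are real parameters, so the spaces involved cannot be types. They are carriers
  inside \<open>'i \<Rightarrow> 'k\<close> with their own norm. Maps between them are functions on the whole ambient type
  of which only the values on the carrier matter.

  The scalars range over the sort \<open>{real_normed_field, euclidean_space}\<close>, whose members are, up to
  isometric isomorphism, exactly the reals and the complex numbers; linearity, subspaces and
  dimension are over \<open>'k\<close>.
\<close>

definition fscale :: "'k::field \<Rightarrow> ('i \<Rightarrow> 'k) \<Rightarrow> 'i \<Rightarrow> 'k" where
  "fscale c x = (\<lambda>i. c * x i)"

global_interpretation fun_vs: vector_space "fscale :: 'k::field \<Rightarrow> ('i \<Rightarrow> 'k) \<Rightarrow> 'i \<Rightarrow> 'k"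
  by unfold_locales (auto simp: fscale_def fun_eq_iff algebra_simps)

record ('i, 'k) fspace =
  vectors :: "('i \<Rightarrow> 'k) set"
  vnorm :: "('i \<Rightarrow> 'k) \<Rightarrow> real"

definition bounded_ops :: "('i, 'k::field) fspace \<Rightarrow> ('j, 'k) fspace
    \<Rightarrow> (('i \<Rightarrow> 'k) \<Rightarrow> 'j \<Rightarrow> 'k) set" where
  "bounded_ops X Y = {S.
     (\<forall>x\<in>vectors X. S x \<in> vectors Y) \<and>
     (\<forall>x\<in>vectors X. \<forall>y\<in>vectors X. S (x + y) = S x + S y) \<and>
     (\<forall>c. \<forall>x\<in>vectors X. S (fscale c x) = fscale c (S x)) \<and>
     (\<exists>C. \<forall>x\<in>vectors X. vnorm Y (S x) \<le> C * vnorm X x)}"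

definition isomorphisms :: "('i, 'k::field) fspace \<Rightarrow> ('j, 'k) fspace
    \<Rightarrow> (('i \<Rightarrow> 'k) \<Rightarrow> 'j \<Rightarrow> 'k) set" where
  "isomorphisms X Y = {U \<in> bounded_ops X Y.
     bij_betw U (vectors X) (vectors Y) \<and> inv_into (vectors X) U \<in> bounded_ops Y X}"

text \<open>
  The condition \<open>n \<ge> 1\<close> is needed: the infimum over the empty unit sphere of the zero subspace is
  not meaningful in \<open>real\<close>. For \<open>n \<ge> 1\<close> the equation \<open>dim E = n\<close> also forces \<open>E\<close> to be finite
  dimensional, whereas the library assigns dimension 0 to infinite-dimensional subspaces.
\<close>

definition finitely_strictly_singular :: "('i, 'k::field) fspace \<Rightarrow> ('j, 'k) fspace
    \<Rightarrow> (('i \<Rightarrow> 'k) \<Rightarrow> 'j \<Rightarrow> 'k) \<Rightarrow> bool" where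
  "finitely_strictly_singular X Y S \<longleftrightarrow>
     (\<forall>\<epsilon>>0. \<exists>n\<ge>1. \<forall>E. E \<subseteq> vectors X \<and> fun_vs.subspace E \<and> fun_vs.dim E = n \<longrightarrow>
        (INF x\<in>{x \<in> E. vnorm X x = 1}. vnorm Y (S x)) < \<epsilon>)"

definition ell :: "real \<Rightarrow> (nat, 'k::{real_normed_field, euclidean_space}) fspace" where
  "ell r = \<lparr>vectors = {x. summable (\<lambda>i. norm (x i) powr r)},
            vnorm = (\<lambda>x. (\<Sum>i. norm (x i) powr r) powr (1 / r))\<rparr>"

text \<open>
  The \<open>\<ell>\<^sub>r\<close>-sum of the spaces \<open>\<ell>\<^sub>2\<^sup>n\<close>: the \<open>n\<close>-th block of \<open>x\<close> consists of the
  coordinates \<open>x (n, i)\<close> with \<open>i < n\<close>. Block 0 has no coordinates, so the sum starts with \<open>n = 1\<close>.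
\<close>

definition block_norm :: "(nat \<times> nat \<Rightarrow> 'k::real_normed_vector) \<Rightarrow> nat \<Rightarrow> real" where
  "block_norm x n = L2_set (\<lambda>i. norm (x (n, i))) {..<n}"

definition ell2n_sum :: "real \<Rightarrow> (nat \<times> nat, 'k::{real_normed_field, euclidean_space}) fspace" where
  "ell2n_sum r = \<lparr>vectors = {x. (\<forall>n i. n \<le> i \<longrightarrow> x (n, i) = 0) \<and>
                                summable (\<lambda>n. block_norm x n powr r)},
                  vnorm = (\<lambda>x. (\<Sum>n. block_norm x n powr r) powr (1 / r))\<rparr>"

text \<open>The formal identity \<open>I\<^sub>2\<^sub>,\<^sub>p\<^sub>,\<^sub>q\<close>; both direct sums live in the same ambient type.\<close>

definition formal_identity :: "(nat \<times> nat \<Rightarrow> 'k) \<Rightarrow> nat \<times> nat \<Rightarrow> 'k" where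
  "formal_identity x = x"

definition pelczynski_decomposition_operator :: "real \<Rightarrow> real
    \<Rightarrow> ((nat \<Rightarrow> 'k::{real_normed_field, euclidean_space}) \<Rightarrow> nat \<Rightarrow> 'k) \<Rightarrow> bool" where
  "pelczynski_decomposition_operator p q T \<longleftrightarrow>
     (\<exists>U \<in> isomorphisms (ell p) (ell2n_sum p). \<exists>V \<in> isomorphisms (ell2n_sum q) (ell q).
        \<forall>x\<in>vectors (ell p). T x = V (formal_identity (U x)))"

end

theory Submission
  imports Defs
begin

text \<open>
  The theorem follows from a factorisation of the formal identity through \<open>R\<close>: once
  \<open>I = A R B\<close> with \<open>B\<close> from the \<open>\<ell>\<^sub>p\<close>-sum into \<open>\<ell>\<^sub>p\<close> and \<open>A\<close> from \<open>\<ell>\<^sub>q\<close> into the \<open>\<ell>\<^sub>q\<close>-sum, every operator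
  \<open>V I U\<close> equals \<open>(V A) R (B U)\<close>. To obtain \<open>A\<close> and \<open>B\<close> one needs, for every \<open>h\<close>, a copy of
  \<open>\<ell>\<^sub>2\<^sup>h\<close> in \<open>\<ell>\<^sub>p\<close> whose image under \<open>R\<close> is a copy of \<open>\<ell>\<^sub>2\<^sup>h\<close> that is complemented in \<open>\<ell>\<^sub>q\<close>, with
  constants independent of \<open>h\<close>, and these copies have to be supported on disjoint intervals.

  If \<open>R\<close> is not finitely strictly singular, it is bounded below by a fixed \<open>\<epsilon>\<close> on subspaces \<open>E\<close> of
  any finite dimension. Such an \<open>E\<close> embeds both into \<open>\<ell>\<^sub>p\<close> with \<open>p \<le> 2\<close> and, through \<open>R\<close>, into
  \<open>\<ell>\<^sub>q\<close> with \<open>q \<ge> 2\<close>, and this forces it to be Hilbertian. In concrete terms, Khintchine's inequality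
  and the 2-concavity of \<open>\<ell>\<^sub>p\<close> show that the square functions \<open>(\<Sum>\<^sub>x \<bar>R x\<bar>\<^sup>2)\<^sup>1\<^sup>/\<^sup>2\<close> of finite families
  in \<open>E\<close> with \<open>\<Sum>\<^sub>x \<parallel>x\<parallel>\<^sup>2 = 1\<close> have \<open>\<ell>\<^sub>q\<close>-norm bounded below (lemma \<open>square_function_lower_bound\<close>). The
  squares of these functions form a convex set, and as \<open>q/2 \<ge> 1\<close>, a separation argument (lemma
  \<open>separating_weights\<close>) gives weights \<open>\<beta>\<close> such that \<open>\<Sum>\<^sub>j \<beta>\<^sub>j \<bar>y\<^sub>j\<bar>\<^sup>2 \<le> \<parallel>y\<parallel>\<^sub>q\<^sup>2\<close> for all \<open>y\<close>, while
  \<open>\<Sum>\<^sub>j \<beta>\<^sub>j \<bar>(R x)\<^sub>j\<bar>\<^sup>2 \<ge> c \<parallel>x\<parallel>\<^sub>p\<^sup>2\<close> for \<open>x\<close> in \<open>E\<close> (lemma \<open>hilbertian_weights\<close>). The weighted Hilbert norm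
  provides everything at once: vectors of \<open>E\<close> with orthonormal images span a copy of
  \<open>\<ell>\<^sub>2\<^sup>h\<close>, and the orthogonal projection is bounded on \<open>\<ell>\<^sub>q\<close> by Bessel's inequality.

  As \<open>E\<close> can be taken as large as one likes, finitely many linear conditions can be imposed on the
  chosen vectors. This puts the copies on disjoint intervals and makes the coefficient functionals
  of one copy vanish on the images of all the others (lemmas \<open>hilbert_block_exists\<close> and
  \<open>hilbert_block_sequence\<close>). The blocks are then glued together in lemma \<open>formal_identity_factors\<close>.
\<close>

section \<open>Signed averages and Khintchine's inequality\<close>

lemma powr_le_exp:
  fixes u q :: real
  assumes "0 \<le> u" "0 < q"
  shows "u powr q \<le> q powr q * exp u"
proof -
  have "u / q \<le> exp (u / q)"
    using exp_ge_add_one_self[of "u / q"] by linarith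
  then have "(u / q) powr q \<le> exp (u / q) powr q"
    using assms by (intro powr_mono2) auto
  also have "\<dots> = exp u"
    using assms by (simp add: powr_def)
  finally have "q powr q * (u / q) powr q \<le> q powr q * exp u"
    by (intro mult_left_mono) auto
  then show ?thesis
    using assms by (simp flip: powr_mult)
qed

text \<open>The difference \<open>x\<^sup>2 / 2 - ln (cosh x)\<close> has derivative \<open>x - tanh x\<close>, which is nonnegative for \<open>x \<ge> 0\<close>.\<close>

lemma cosh_le_exp_half_square: "cosh x \<le> exp (x\<^sup>2 / 2)" for x :: real
proof -
  have pos: "cosh x \<le> exp (x\<^sup>2 / 2)" if "0 \<le> x" for x :: real
  proof -
    have sinh_le: "sinh y \<le> y * cosh y" if "0 \<le> y" for y :: real
    proof -
      have "0 * cosh 0 - sinh 0 \<le> y * cosh y - sinh y"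
        by (rule DERIV_nonneg_imp_nondecreasing[OF that])
           (auto intro!: derivative_eq_intros exI)
      then show ?thesis by simp
    qed
    have "0\<^sup>2 / 2 - ln (cosh 0) \<le> x\<^sup>2 / 2 - ln (cosh x)"
    proof (rule DERIV_nonneg_imp_nondecreasing[OF that])
      fix y :: real assume y: "0 \<le> y" "y \<le> x"
      have "((\<lambda>x. x\<^sup>2 / 2 - ln (cosh x)) has_real_derivative y - sinh y / cosh y) (at y)"
        by (auto intro!: derivative_eq_intros simp: cosh_real_pos)
      moreover have "0 \<le> y - sinh y / cosh y"
        using sinh_le[OF y(1)] by (simp add: field_simps cosh_real_pos)
      ultimately show "\<exists>z. ((\<lambda>x. x\<^sup>2 / 2 - ln (cosh x)) has_real_derivative z) (at y) \<and> 0 \<le> z"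
        by blast
    qed
    then have "exp (ln (cosh x)) \<le> exp (x\<^sup>2 / 2)"
      by (subst exp_le_cancel_iff) simp
    then show ?thesis
      by (subst (asm) exp_ln) (simp_all add: cosh_real_pos)
  qed
  show ?thesis
    using pos[of x] pos[of "- x"] by (cases "0 \<le> x") auto
qed

lemma powr_sum_le_sum_powr:
  fixes f :: "'b \<Rightarrow> real"
  assumes "finite I" "\<And>i. i \<in> I \<Longrightarrow> 0 \<le> f i" "0 < q"
  shows "(\<Sum>i\<in>I. f i) powr q \<le> real (card I) powr q * (\<Sum>i\<in>I. f i powr q)"
proof (cases "I = {}")
  case False
  define m where "m = Max (f ` I)"
  have "m \<in> f ` I"
    using False assms(1) unfolding m_def by (intro Max_in) auto
  then obtain k where k: "k \<in> I" "f k = m" by auto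
  have "f i \<le> m" if "i \<in> I" for i
    using that assms(1) unfolding m_def by simp
  then have "(\<Sum>i\<in>I. f i) \<le> real (card I) * m"
    by (simp add: sum_bounded_above)
  then have "(\<Sum>i\<in>I. f i) powr q \<le> (real (card I) * m) powr q"
    using assms by (intro powr_mono2 sum_nonneg) auto
  also have "\<dots> = real (card I) powr q * f k powr q"
    using k assms(2) by (simp add: powr_mult)
  also have "\<dots> \<le> real (card I) powr q * (\<Sum>i\<in>I. f i powr q)"
    using k assms by (intro mult_left_mono member_le_sum) auto
  finally show ?thesis .
qed simp

text \<open>
  The average of \<open>F\<close> over all signed sums \<open>a \<plusminus> x\<^sub>1 \<plusminus> \<dots> \<plusminus> x\<^sub>m\<close>, that is, the expectation of \<open>F\<close> at
  a Rademacher sum. The recursion replaces a probability space on the signs.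
\<close>

fun sign_avg :: "('v::ab_group_add \<Rightarrow> real) \<Rightarrow> 'v list \<Rightarrow> 'v \<Rightarrow> real" where
  "sign_avg F [] a = F a"
| "sign_avg F (x # xs) a = (sign_avg F xs (a + x) + sign_avg F xs (a - x)) / 2"

lemma sign_avg_mono: "(\<And>s. F s \<le> G s) \<Longrightarrow> sign_avg F xs a \<le> sign_avg G xs a"
proof (induction xs arbitrary: a)
  case (Cons x xs)
  show ?case
    using Cons.IH[OF Cons.prems, of "a + x"] Cons.IH[OF Cons.prems, of "a - x"] by simp
qed simp

lemma sign_avg_add: "sign_avg (\<lambda>s. F s + G s) xs a = sign_avg F xs a + sign_avg G xs a"
  by (induction xs arbitrary: a) (auto simp: field_simps)

lemma sign_avg_cmult: "sign_avg (\<lambda>s. c * F s) xs a = c * sign_avg F xs a"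
  by (induction xs arbitrary: a) (auto simp: field_simps)

lemma sign_avg_const: "sign_avg (\<lambda>s. c) xs a = c"
  by (induction xs arbitrary: a) auto

lemma sign_avg_sum: "sign_avg (\<lambda>s. \<Sum>i\<in>I. F i s) xs a = (\<Sum>i\<in>I. sign_avg (F i) xs a)"
  by (induction xs arbitrary: a) (auto simp: sum.distrib simp flip: sum_divide_distrib)

lemma sign_avg_invariant: "(\<And>x s. x \<in> set xs \<Longrightarrow> F (s + x) = F s \<and> F (s - x) = F s) \<Longrightarrow> sign_avg F xs a = F a"
proof (induction xs arbitrary: a)
  case (Cons x xs)
  have "sign_avg F xs b = F b" for b
    using Cons by (intro Cons.IH) auto
  then show ?case using Cons.prems[of x a] by simp
qed simp

lemma sign_avg_square:
  fixes \<phi> :: "'v::ab_group_add \<Rightarrow> 'e::real_inner"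
  assumes "Modules.additive \<phi>"
  shows "sign_avg (\<lambda>s. (norm (\<phi> s))\<^sup>2) xs a = (norm (\<phi> a))\<^sup>2 + (\<Sum>x\<leftarrow>xs. (norm (\<phi> x))\<^sup>2)"
  by (induction xs arbitrary: a)
     (auto simp: additive.add[OF assms] additive.diff[OF assms] power2_norm_eq_inner
        inner_add inner_diff inner_commute field_simps)

lemma sign_avg_exp_le:
  fixes \<phi> :: "'v::ab_group_add \<Rightarrow> real"
  assumes "Modules.additive \<phi>"
  shows "sign_avg (\<lambda>s. exp (\<phi> s)) xs a \<le> exp (\<phi> a + (\<Sum>x\<leftarrow>xs. (\<phi> x)\<^sup>2) / 2)"
proof (induction xs arbitrary: a)
  case (Cons x xs)
  let ?S = "(\<Sum>x\<leftarrow>xs. (\<phi> x)\<^sup>2) / 2"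
  have "sign_avg (\<lambda>s. exp (\<phi> s)) (x # xs) a
      \<le> (exp (\<phi> (a + x) + ?S) + exp (\<phi> (a - x) + ?S)) / 2"
    using Cons.IH[of "a + x"] Cons.IH[of "a - x"] by simp
  also have "\<dots> = exp (\<phi> a + ?S) * cosh (\<phi> x)"
    using exp_add[of "\<phi> a + ?S" "\<phi> x"] exp_add[of "\<phi> a + ?S" "- \<phi> x"]
    by (simp add: additive.add[OF assms] additive.diff[OF assms] cosh_field_def algebra_simps)
  also have "\<dots> \<le> exp (\<phi> a + ?S) * exp ((\<phi> x)\<^sup>2 / 2)"
    by (intro mult_left_mono cosh_le_exp_half_square) auto
  finally show ?case
    by (simp add: exp_add[symmetric] add_divide_distrib algebra_simps)
qed simp

lemma additive_uminus: "Modules.additive \<phi> \<Longrightarrow> Modules.additive (\<lambda>s. - \<phi> s)"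
  by (simp add: Modules.additive_def)

text \<open>
  Every power of \<open>\<bar>u\<bar>\<close> is at most a multiple of \<open>exp u + exp (- u)\<close>, and the exponential moments of a signed sum
  factorise into values of \<open>cosh\<close>. Coordinates with respect to a basis reduce to real scalars.
\<close>

lemma khintchine_normalised:
  fixes \<phi> :: "'v::ab_group_add \<Rightarrow> 'e::euclidean_space"
  assumes "Modules.additive \<phi>" "0 < q" "(\<Sum>x\<leftarrow>xs. (norm (\<phi> x))\<^sup>2) \<le> 1"
  shows "sign_avg (\<lambda>s. norm (\<phi> s) powr q) xs 0
           \<le> real DIM('e) powr q * (real DIM('e) * (2 * (q powr q * exp (1 / 2))))"
proof -
  have comp: "sign_avg (\<lambda>s. \<bar>\<phi> s \<bullet> b\<bar> powr q) xs 0 \<le> 2 * (q powr q * exp (1 / 2))"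
    if b: "b \<in> Basis" for b
  proof -
    let ?\<psi> = "\<lambda>s. \<phi> s \<bullet> b"
    have add: "Modules.additive ?\<psi>"
      using assms(1) by (simp add: Modules.additive_def inner_add)
    have "(\<Sum>x\<leftarrow>xs. (?\<psi> x)\<^sup>2) \<le> (\<Sum>x\<leftarrow>xs. (norm (\<phi> x))\<^sup>2)"
      using b Basis_le_norm by (intro sum_list_mono) (auto simp: abs_le_square_iff[symmetric])
    then have le1: "(\<Sum>x\<leftarrow>xs. (?\<psi> x)\<^sup>2) \<le> 1"
      using assms(3) by linarith
    have "\<bar>?\<psi> s\<bar> powr q \<le> q powr q * (exp (?\<psi> s) + exp (- ?\<psi> s))" for s
    proof -
      have "\<bar>?\<psi> s\<bar> powr q \<le> q powr q * exp \<bar>?\<psi> s\<bar>"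
        using assms(2) by (intro powr_le_exp) auto
      also have "\<dots> \<le> q powr q * (exp (?\<psi> s) + exp (- ?\<psi> s))"
        by (intro mult_left_mono) (auto simp: abs_if)
      finally show ?thesis .
    qed
    then have "sign_avg (\<lambda>s. \<bar>?\<psi> s\<bar> powr q) xs 0
        \<le> sign_avg (\<lambda>s. q powr q * (exp (?\<psi> s) + exp (- ?\<psi> s))) xs 0"
      by (intro sign_avg_mono) auto
    also have "\<dots> = q powr q * (sign_avg (\<lambda>s. exp (?\<psi> s)) xs 0 + sign_avg (\<lambda>s. exp (- ?\<psi> s)) xs 0)"
      by (simp add: sign_avg_cmult sign_avg_add)
    also have "\<dots> \<le> q powr q * (exp (1 / 2) + exp (1 / 2))"
    proof (intro mult_left_mono add_mono)
      show "sign_avg (\<lambda>s. exp (?\<psi> s)) xs 0 \<le> exp (1 / 2)"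
        using sign_avg_exp_le[OF add, of xs 0] le1 additive.zero[OF add]
        by (auto elim!: order_trans)
      show "sign_avg (\<lambda>s. exp (- ?\<psi> s)) xs 0 \<le> exp (1 / 2)"
        using sign_avg_exp_le[OF additive_uminus[OF add], of xs 0] le1 additive.zero[OF add]
        by (auto elim!: order_trans)
    qed auto
    finally show ?thesis by (simp add: algebra_simps)
  qed
  have "norm (\<phi> s) powr q \<le> real DIM('e) powr q * (\<Sum>b\<in>Basis. \<bar>\<phi> s \<bullet> b\<bar> powr q)" for s
  proof -
    have "norm (\<phi> s) powr q \<le> (\<Sum>b\<in>Basis. \<bar>\<phi> s \<bullet> b\<bar>) powr q"
      using assms(2) by (intro powr_mono2 norm_le_l1) auto
    also have "\<dots> \<le> real DIM('e) powr q * (\<Sum>b\<in>Basis. \<bar>\<phi> s \<bullet> b\<bar> powr q)"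
      using assms(2) by (intro powr_sum_le_sum_powr) auto
    finally show ?thesis .
  qed
  then have "sign_avg (\<lambda>s. norm (\<phi> s) powr q) xs 0
      \<le> sign_avg (\<lambda>s. real DIM('e) powr q * (\<Sum>b\<in>Basis. \<bar>\<phi> s \<bullet> b\<bar> powr q)) xs 0"
    by (intro sign_avg_mono)
  also have "\<dots> = real DIM('e) powr q * (\<Sum>b\<in>Basis. sign_avg (\<lambda>s. \<bar>\<phi> s \<bullet> b\<bar> powr q) xs 0)"
    by (simp add: sign_avg_cmult sign_avg_sum)
  also have "\<dots> \<le> real DIM('e) powr q * (real DIM('e) * (2 * (q powr q * exp (1 / 2))))"
    using comp by (intro mult_left_mono sum_bounded_above) auto
  finally show ?thesis .
qed

lemma sum_list_norm_zero:
  fixes \<phi> :: "'v \<Rightarrow> 'e::real_normed_vector"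
  shows "(\<Sum>x\<leftarrow>xs. (norm (\<phi> x))\<^sup>2) = 0 \<longleftrightarrow> (\<forall>x\<in>set xs. \<phi> x = 0)"
  by (subst sum_list_nonneg_eq_0_iff) auto

lemma khintchine_upper:
  assumes "0 < q"
  shows "\<exists>C\<ge>1. \<forall>(\<phi> :: 'v::ab_group_add \<Rightarrow> 'e::euclidean_space) xs. Modules.additive \<phi> \<longrightarrow>
    sign_avg (\<lambda>s. norm (\<phi> s) powr q) xs 0 \<le> C * (\<Sum>x\<leftarrow>xs. (norm (\<phi> x))\<^sup>2) powr (q / 2)"
proof -
  define C where "C = max 1 (real DIM('e) powr q * (real DIM('e) * (2 * (q powr q * exp (1 / 2)))))"
  have "sign_avg (\<lambda>s. norm (\<phi> s) powr q) xs 0 \<le> C * (\<Sum>x\<leftarrow>xs. (norm (\<phi> x))\<^sup>2) powr (q / 2)"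
    if add: "Modules.additive \<phi>" for \<phi> :: "'v \<Rightarrow> 'e" and xs
  proof -
    let ?S = "\<Sum>x\<leftarrow>xs. (norm (\<phi> x))\<^sup>2"
    have S0: "0 \<le> ?S" by (intro sum_list_nonneg) auto
    show ?thesis
    proof (cases "?S = 0")
      case True
      then have "\<forall>x\<in>set xs. \<phi> x = 0" by (simp add: sum_list_norm_zero)
      then have "sign_avg (\<lambda>s. norm (\<phi> s) powr q) xs 0 = 0"
        by (subst sign_avg_invariant)
           (auto simp: additive.add[OF add] additive.diff[OF add] additive.zero[OF add])
      then show ?thesis using True assms by simp
    next
      case False
      define r where "r = sqrt ?S"
      have r: "0 < r" "r\<^sup>2 = ?S" using False S0 by (auto simp: r_def)
      let ?\<psi> = "\<lambda>s. \<phi> s /\<^sub>R r"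
      have add': "Modules.additive ?\<psi>"
        using add by (simp add: Modules.additive_def scaleR_add_right)
      have "(\<Sum>x\<leftarrow>xs. (norm (?\<psi> x))\<^sup>2) = ?S / r\<^sup>2"
        by (induction xs) (auto simp: power_mult_distrib power_inverse divide_inverse algebra_simps)
      also have "\<dots> = 1" using r False by simp
      finally have "sign_avg (\<lambda>s. norm (?\<psi> s) powr q) xs 0 \<le> C"
        using khintchine_normalised[OF add' assms, of xs] by (auto simp: C_def)
      then have "r powr q * sign_avg (\<lambda>s. norm (?\<psi> s) powr q) xs 0 \<le> r powr q * C"
        by (intro mult_left_mono) auto
      moreover have "r powr q * sign_avg (\<lambda>s. norm (?\<psi> s) powr q) xs 0
          = sign_avg (\<lambda>s. norm (\<phi> s) powr q) xs 0"
        using r by (simp flip: sign_avg_cmult powr_mult mult.assoc)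
      moreover have "r powr q = ?S powr (q / 2)"
        using r(1) unfolding r(2)[symmetric] by (simp add: powr_powr flip: powr_numeral)
      ultimately show ?thesis by (simp add: mult.commute)
    qed
  qed
  then show ?thesis by (intro exI[of _ C]) (auto simp: C_def)
qed

text \<open>
  The second moment of a signed sum is known exactly and the fourth is at most a multiple of its
  square. Below the level \<open>L\<close> the square is at most \<open>L powr (2 - p)\<close> times the \<open>p\<close>-th power, and above
  it the square is at most \<open>1/L\<^sup>2\<close> times the fourth power; a large \<open>L\<close> absorbs the latter.
\<close>

lemma khintchine_lower:
  assumes "0 < p" "p \<le> 2"
  shows "\<exists>C>0. \<forall>(\<phi> :: 'v::ab_group_add \<Rightarrow> 'e::euclidean_space) xs. Modules.additive \<phi> \<longrightarrow>
    (\<Sum>x\<leftarrow>xs. (norm (\<phi> x))\<^sup>2) powr (p / 2) \<le> C * sign_avg (\<lambda>s. norm (\<phi> s) powr p) xs 0"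
proof -
  obtain D :: real where D: "D \<ge> 1" "\<And>(\<phi> :: 'v \<Rightarrow> 'e) xs. Modules.additive \<phi> \<Longrightarrow>
      sign_avg (\<lambda>s. norm (\<phi> s) powr 4) xs 0 \<le> D * (\<Sum>x\<leftarrow>xs. (norm (\<phi> x))\<^sup>2) powr (4 / 2)"
    using khintchine_upper[of 4, where 'v = 'v and 'e = 'e] by fastforce
  define L where "L = sqrt (2 * D)"
  have L: "0 < L" "L\<^sup>2 = 2 * D" using D(1) by (auto simp: L_def)
  have split: "u\<^sup>2 \<le> L powr (2 - p) * u powr p + 1 / (2 * D) * u powr 4" if "0 \<le> u" for u :: real
  proof (cases "u \<le> L")
    case True
    have "u\<^sup>2 = u powr (2 - p) * u powr p"
      using that assms by (cases "u = 0") (auto simp flip: powr_add)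
    also have "\<dots> \<le> L powr (2 - p) * u powr p"
      using True that assms by (intro mult_right_mono powr_mono2) auto
    also have "\<dots> \<le> L powr (2 - p) * u powr p + 1 / (2 * D) * u powr 4"
      using D(1) by simp
    finally show ?thesis .
  next
    case False
    then have "2 * D \<le> u\<^sup>2" using L by (metis less_eq_real_def not_le power_mono)
    then have "2 * D * u\<^sup>2 \<le> u\<^sup>2 * u\<^sup>2" by (intro mult_right_mono) auto
    then have "u\<^sup>2 \<le> 1 / (2 * D) * u ^ 4"
      using D(1) by (simp add: field_simps power4_eq_xxxx power2_eq_square)
    moreover have "0 \<le> L powr (2 - p) * u powr p" by simp
    moreover have "u powr 4 = u ^ 4"
      using False L(1) by (simp flip: powr_numeral)
    ultimately show ?thesis by (simp only: add_increasing)
  qed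
  define C where "C = 2 * L powr (2 - p)"
  have "(\<Sum>x\<leftarrow>xs. (norm (\<phi> x))\<^sup>2) powr (p / 2) \<le> C * sign_avg (\<lambda>s. norm (\<phi> s) powr p) xs 0"
    if add: "Modules.additive \<phi>" for \<phi> :: "'v \<Rightarrow> 'e" and xs
  proof -
    let ?S = "\<Sum>x\<leftarrow>xs. (norm (\<phi> x))\<^sup>2"
    have S0: "0 \<le> ?S" by (intro sum_list_nonneg) auto
    show ?thesis
    proof (cases "?S = 0")
      case True
      have "sign_avg (\<lambda>s. 0) xs 0 \<le> sign_avg (\<lambda>s. norm (\<phi> s) powr p) xs 0"
        by (intro sign_avg_mono) auto
      then show ?thesis using True assms by (simp add: sign_avg_const C_def)
    next
      case False
      define r where "r = sqrt ?S"
      have r: "0 < r" "r\<^sup>2 = ?S" using False S0 by (auto simp: r_def)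
      let ?\<psi> = "\<lambda>s. \<phi> s /\<^sub>R r"
      have add': "Modules.additive ?\<psi>"
        using add by (simp add: Modules.additive_def scaleR_add_right)
      have one: "(\<Sum>x\<leftarrow>xs. (norm (?\<psi> x))\<^sup>2) = 1"
      proof -
        have "(\<Sum>x\<leftarrow>xs. (norm (?\<psi> x))\<^sup>2) = ?S / r\<^sup>2"
          by (induction xs) (auto simp: power_mult_distrib power_inverse divide_inverse algebra_simps)
        then show ?thesis using r False by simp
      qed
      have "1 = sign_avg (\<lambda>s. (norm (?\<psi> s))\<^sup>2) xs 0"
        using sign_avg_square[OF add', of xs 0] one additive.zero[OF add'] by simp
      also have "\<dots> \<le> sign_avg (\<lambda>s. L powr (2 - p) * norm (?\<psi> s) powr p
                     + 1 / (2 * D) * norm (?\<psi> s) powr 4) xs 0"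
        by (intro sign_avg_mono split) auto
      also have "\<dots> = L powr (2 - p) * sign_avg (\<lambda>s. norm (?\<psi> s) powr p) xs 0
                     + 1 / (2 * D) * sign_avg (\<lambda>s. norm (?\<psi> s) powr 4) xs 0"
        by (simp only: sign_avg_add sign_avg_cmult)
      also have "\<dots> \<le> L powr (2 - p) * sign_avg (\<lambda>s. norm (?\<psi> s) powr p) xs 0 + 1 / (2 * D) * D"
        using D(2)[OF add', of xs] D(1) one by (intro add_left_mono mult_left_mono) auto
      finally have "1 \<le> C * sign_avg (\<lambda>s. norm (?\<psi> s) powr p) xs 0"
        using D(1) by (simp add: C_def field_simps)
      then have "r powr p * 1 \<le> r powr p * (C * sign_avg (\<lambda>s. norm (?\<psi> s) powr p) xs 0)"
        by (intro mult_left_mono) auto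
      moreover have "r powr p * sign_avg (\<lambda>s. norm (?\<psi> s) powr p) xs 0
          = sign_avg (\<lambda>s. norm (\<phi> s) powr p) xs 0"
        using r by (simp flip: sign_avg_cmult powr_mult mult.assoc)
      moreover have "r powr p = ?S powr (p / 2)"
        using r(1) unfolding r(2)[symmetric] by (simp add: powr_powr flip: powr_numeral)
      ultimately show ?thesis by (simp add: algebra_simps)
    qed
  qed
  then show ?thesis
    using L by (intro exI[of _ C]) (auto simp: C_def)
qed

section \<open>Lower bounds for square functions\<close>

definition pnorm :: "real \<Rightarrow> nat \<Rightarrow> (nat \<Rightarrow> 'k::real_normed_vector) \<Rightarrow> real" where
  "pnorm r t x = (\<Sum>j<t. norm (x j) powr r) powr (1 / r)"

lemma pnorm_nonneg [simp]: "0 \<le> pnorm r t x"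
  by (simp add: pnorm_def)

lemma pnorm_powr: "0 < r \<Longrightarrow> pnorm r t x powr r = (\<Sum>j<t. norm (x j) powr r)"
  by (simp add: pnorm_def powr_powr sum_nonneg)

lemma norm_le_pnorm:
  assumes "0 < r" "j < t"
  shows "norm (x j) \<le> pnorm r t x"
proof -
  have "(norm (x j) powr r) powr (1 / r) \<le> (\<Sum>j<t. norm (x j) powr r) powr (1 / r)"
    using assms by (intro powr_mono2 member_le_sum) auto
  then show ?thesis using assms by (simp add: powr_powr pnorm_def)
qed

lemma pnorm_cmult:
  fixes x :: "nat \<Rightarrow> 'k::real_normed_field"
  assumes "0 < r"
  shows "pnorm r t (fscale c x) = norm c * pnorm r t x"
  using assms
  by (simp add: pnorm_def fscale_def norm_mult powr_mult powr_powr sum_nonneg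
      flip: sum_distrib_left)

lemma sum_list_sum_swap:
  "(\<Sum>x\<leftarrow>xs. \<Sum>j\<in>J. f x j) = (\<Sum>j\<in>J. \<Sum>x\<leftarrow>xs. f x j)" for f :: "'v \<Rightarrow> 'j \<Rightarrow> real"
  by (induction xs) (auto simp: sum.distrib)

lemma young_powr:
  fixes a w s :: real
  assumes "0 \<le> a" "0 \<le> w" "1 < s"
  shows "a * w powr (s - 1) \<le> a powr s / s + w powr s * (s - 1) / s"
proof -
  have "a * w powr (s - 1) \<le> a powr s / s + (w powr (s - 1)) powr (s / (s - 1)) / (s / (s - 1))"
    using assms by (intro Youngs_inequality) (auto simp: field_simps)
  then show ?thesis using assms by (simp add: powr_powr)
qed

lemma sum_list_powr_concave:
  fixes \<alpha> v :: "'v \<Rightarrow> real"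
  assumes r: "0 < r" "r \<le> 1"
    and nonneg: "\<And>x. x \<in> set xs \<Longrightarrow> 0 \<le> \<alpha> x" "\<And>x. x \<in> set xs \<Longrightarrow> 0 \<le> v x"
    and one: "(\<Sum>x\<leftarrow>xs. \<alpha> x) = 1"
  shows "(\<Sum>x\<leftarrow>xs. \<alpha> x * v x powr r) \<le> (\<Sum>x\<leftarrow>xs. \<alpha> x * v x) powr r"
proof -
  define w where "w = (\<Sum>x\<leftarrow>xs. \<alpha> x * v x)"
  have w0: "0 \<le> w" unfolding w_def using nonneg by (intro sum_list_nonneg) auto
  show ?thesis
  proof (cases "w = 0")
    case True
    then have "\<forall>x\<in>set xs. \<alpha> x * v x = 0"
      unfolding w_def using nonneg by (subst (asm) sum_list_nonneg_eq_0_iff) auto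
    then have "(\<Sum>x\<leftarrow>xs. \<alpha> x * v x powr r) = (\<Sum>x\<leftarrow>xs. 0)"
      by (intro arg_cong[of _ _ sum_list] map_cong) auto
    then show ?thesis by simp
  next
    case False
    with w0 have w: "0 < w" by simp
    have "\<alpha> x * v x powr r * w powr (1 - r) \<le> r * (\<alpha> x * v x) + (1 - r) * w * \<alpha> x"
      if "x \<in> set xs" for x
    proof -
      have "v x powr r * w powr (1 - r) \<le> r * v x + (1 - r) * w"
        using Youngs_inequality_0[of r "1 - r" "v x" w] r w nonneg(2)[OF that]
        by (cases "v x = 0") auto
      from mult_left_mono[OF this nonneg(1)[OF that]] show ?thesis
        by (simp add: algebra_simps)
    qed
    then have "(\<Sum>x\<leftarrow>xs. \<alpha> x * v x powr r * w powr (1 - r))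
        \<le> (\<Sum>x\<leftarrow>xs. r * (\<alpha> x * v x) + (1 - r) * w * \<alpha> x)"
      by (intro sum_list_mono)
    also have "\<dots> = r * w + (1 - r) * w"
      by (simp only: sum_list_addf sum_list_const_mult one w_def)
    also have "\<dots> = w powr r * w powr (1 - r)"
      using w by (simp add: algebra_simps flip: powr_add)
    finally have "(\<Sum>x\<leftarrow>xs. \<alpha> x * v x powr r) * w powr (1 - r) \<le> w powr r * w powr (1 - r)"
      by (simp add: sum_list_mult_const)
    then show ?thesis using w by (simp add: w_def)
  qed
qed

text \<open>
  \<open>\<ell>\<^sub>p\<close> is \<open>2\<close>-concave for \<open>p \<le> 2\<close>: with \<open>\<alpha>\<^sub>x = \<parallel>x\<parallel>\<^sup>2\<close> as weights, apply the concavity of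
  \<open>u powr (p/2)\<close> in every coordinate to the normalised vectors and sum over the coordinates.
\<close>

lemma pnorm_square_function_ge:
  fixes X :: "'v \<Rightarrow> nat \<Rightarrow> 'k::real_normed_vector"
  assumes p: "0 < p" "p \<le> 2" and one: "(\<Sum>x\<leftarrow>xs. (pnorm p t (X x))\<^sup>2) = 1"
  shows "1 \<le> (\<Sum>j<t. (\<Sum>x\<leftarrow>xs. (norm (X x j))\<^sup>2) powr (p / 2))"
proof -
  define \<alpha> where "\<alpha> x = (pnorm p t (X x))\<^sup>2" for x
  define v where "v x j = (norm (X x j))\<^sup>2 / \<alpha> x" for x j
  have \<alpha>v: "\<alpha> x * v x j = (norm (X x j))\<^sup>2" if "j < t" for x j
    using norm_le_pnorm[OF p(1) that, of "X x"] by (auto simp: v_def \<alpha>_def)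
  have "(\<Sum>j<t. \<alpha> x * v x j powr (p / 2)) = \<alpha> x" for x
  proof (cases "\<alpha> x = 0")
    case False
    then have \<alpha>: "0 < \<alpha> x" by (simp add: \<alpha>_def)
    have half: "((u::real)\<^sup>2) powr (p / 2) = u powr p" if "0 \<le> u" for u
      using that by (cases "u = 0") (auto simp: powr_powr simp flip: powr_numeral)
    have "(\<Sum>j<t. v x j powr (p / 2)) = (\<Sum>j<t. norm (X x j) powr p) / \<alpha> x powr (p / 2)"
      by (simp add: v_def powr_divide \<alpha>_def half sum_divide_distrib)
    also have "\<dots> = 1"
      using \<alpha> p by (simp add: \<alpha>_def half flip: pnorm_powr)
    finally show ?thesis by (simp flip: sum_distrib_left)
  qed simp
  then have "1 = (\<Sum>x\<leftarrow>xs. \<Sum>j<t. \<alpha> x * v x j powr (p / 2))"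
    using one by (simp add: \<alpha>_def)
  also have "\<dots> = (\<Sum>j<t. \<Sum>x\<leftarrow>xs. \<alpha> x * v x j powr (p / 2))"
    by (rule sum_list_sum_swap)
  also have "\<dots> \<le> (\<Sum>j<t. (\<Sum>x\<leftarrow>xs. \<alpha> x * v x j) powr (p / 2))"
    using p one by (intro sum_mono sum_list_powr_concave) (auto simp: \<alpha>_def v_def)
  also have "\<dots> = (\<Sum>j<t. (\<Sum>x\<leftarrow>xs. (norm (X x j))\<^sup>2) powr (p / 2))"
    by (intro sum.cong) (simp_all add: \<alpha>v)
  finally show ?thesis .
qed

text \<open>
  Averaging the lower bound \<open>\<delta> \<parallel>X s\<parallel>\<^sub>p \<le> \<parallel>Y s\<parallel>\<^sub>q\<close> over signed sums turns both sides into square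
  functions by Khintchine's inequality; the one on the left is then bounded below by
  2-concavity. This is where \<open>p \<le> 2\<close> enters.
\<close>

lemma square_function_lower_bound:
  fixes \<delta> p q :: real
  assumes p: "0 < p" "p \<le> 2" and pq: "p \<le> q" and \<delta>: "0 < \<delta>"
  shows "\<exists>c>0. \<forall>t (X :: 'v::ab_group_add \<Rightarrow> nat \<Rightarrow> 'k::euclidean_space)
      (Y :: 'v \<Rightarrow> nat \<Rightarrow> 'k) xs.
    (\<forall>j. Modules.additive (\<lambda>a. X a j)) \<longrightarrow> (\<forall>j. Modules.additive (\<lambda>a. Y a j)) \<longrightarrow>
    (\<forall>a. \<delta> * pnorm p t (X a) \<le> pnorm q t (Y a)) \<longrightarrow> (\<Sum>x\<leftarrow>xs. (pnorm p t (X x))\<^sup>2) = 1 \<longrightarrow>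
    c \<le> (\<Sum>j<t. (\<Sum>x\<leftarrow>xs. (norm (Y x j))\<^sup>2) powr (q / 2))"
proof -
  have q: "0 < q" using p pq by simp
  obtain C1 :: real where C1: "C1 > 0" "\<And>(\<phi> :: 'v \<Rightarrow> 'k) xs. Modules.additive \<phi> \<Longrightarrow>
      (\<Sum>x\<leftarrow>xs. (norm (\<phi> x))\<^sup>2) powr (p / 2) \<le> C1 * sign_avg (\<lambda>s. norm (\<phi> s) powr p) xs 0"
    using khintchine_lower[OF p, where 'v = 'v and 'e = 'k] by blast
  obtain C2 :: real where C2: "C2 \<ge> 1" "\<And>(\<phi> :: 'v \<Rightarrow> 'k) xs. Modules.additive \<phi> \<Longrightarrow>
      sign_avg (\<lambda>s. norm (\<phi> s) powr q) xs 0 \<le> C2 * (\<Sum>x\<leftarrow>xs. (norm (\<phi> x))\<^sup>2) powr (q / 2)"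
    using khintchine_upper[OF q, where 'v = 'v and 'e = 'k] by blast
  define D where "D = C1 * \<delta> powr (- p) * (1 + C2)"
  have D: "0 < D" using C1 C2 \<delta> by (simp add: D_def)
  define T where "T = (1 / (2 * D)) powr (1 / p)"
  have T: "0 < T" "T powr p = 1 / (2 * D)" using D p by (auto simp: T_def powr_powr)
  have "T powr q \<le> (\<Sum>j<t. (\<Sum>x\<leftarrow>xs. (norm (Y x j))\<^sup>2) powr (q / 2))"
    if X: "\<And>j. Modules.additive (\<lambda>a. X a j)" and Y: "\<And>j. Modules.additive (\<lambda>a. Y a j)"
      and lower: "\<And>a. \<delta> * pnorm p t (X a) \<le> pnorm q t (Y a)"
      and one: "(\<Sum>x\<leftarrow>xs. (pnorm p t (X x))\<^sup>2) = 1"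
    for t and X Y :: "'v \<Rightarrow> nat \<Rightarrow> 'k" and xs
  proof (rule ccontr)
    let ?M = "\<Sum>j<t. (\<Sum>x\<leftarrow>xs. (norm (Y x j))\<^sup>2) powr (q / 2)"
    assume "\<not> T powr q \<le> ?M"
    then have small: "?M \<le> T powr q" by simp
    have pointwise: "pnorm p t (X s) powr p
        \<le> \<delta> powr (- p) * T powr p * (1 + T powr (- q) * pnorm q t (Y s) powr q)" for s
    proof -
      let ?u = "pnorm q t (Y s) / T"
      have u: "0 \<le> ?u" using T by simp
      have u_le: "?u powr p \<le> 1 + ?u powr q"
      proof (cases "?u \<le> 1")
        case True
        then have "?u powr p \<le> 1" using u p by (intro powr_le1) auto
        then show ?thesis by (simp add: add_increasing2)
      next
        case False
        then have "?u powr p \<le> ?u powr q" using pq by (intro powr_mono) auto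
        then show ?thesis by simp
      qed
      have "pnorm p t (X s) \<le> pnorm q t (Y s) / \<delta>"
        using lower[of s] \<delta> by (simp add: field_simps)
      then have "pnorm p t (X s) powr p \<le> (pnorm q t (Y s) / \<delta>) powr p"
        using p by (intro powr_mono2) auto
      also have "\<dots> = \<delta> powr (- p) * T powr p * ?u powr p"
        using T(1) \<delta> by (simp add: powr_divide powr_minus_divide)
      also have "\<dots> \<le> \<delta> powr (- p) * T powr p * (1 + ?u powr q)"
        using u_le by (intro mult_left_mono) auto
      also have "?u powr q = T powr (- q) * pnorm q t (Y s) powr q"
        using T(1) by (simp add: powr_divide powr_minus_divide)
      finally show ?thesis .
    qed
    have "1 \<le> (\<Sum>j<t. (\<Sum>x\<leftarrow>xs. (norm (X x j))\<^sup>2) powr (p / 2))"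
      by (rule pnorm_square_function_ge[OF p one])
    also have "\<dots> \<le> (\<Sum>j<t. C1 * sign_avg (\<lambda>s. norm (X s j) powr p) xs 0)"
      using C1(2)[OF X] by (intro sum_mono) auto
    also have "\<dots> = C1 * sign_avg (\<lambda>s. pnorm p t (X s) powr p) xs 0"
      using p by (simp add: pnorm_powr sign_avg_sum sum_distrib_left)
    also have "\<dots> \<le> C1 * sign_avg (\<lambda>s. \<delta> powr (- p) * T powr p
        * (1 + T powr (- q) * pnorm q t (Y s) powr q)) xs 0"
      using C1(1) pointwise by (intro mult_left_mono sign_avg_mono) auto
    also have "\<dots> = C1 * (\<delta> powr (- p) * T powr p
        * (1 + T powr (- q) * sign_avg (\<lambda>s. pnorm q t (Y s) powr q) xs 0))"
      by (simp only: sign_avg_cmult sign_avg_add sign_avg_const)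
    also have "sign_avg (\<lambda>s. pnorm q t (Y s) powr q) xs 0
        = (\<Sum>j<t. sign_avg (\<lambda>s. norm (Y s j) powr q) xs 0)"
      using q by (simp add: pnorm_powr sign_avg_sum)
    also have "C1 * (\<delta> powr (- p) * T powr p * (1 + T powr (- q) * \<dots>))
        \<le> C1 * (\<delta> powr (- p) * T powr p * (1 + T powr (- q) * (C2 * T powr q)))"
    proof -
      have "(\<Sum>j<t. sign_avg (\<lambda>s. norm (Y s j) powr q) xs 0) \<le> C2 * ?M"
        unfolding sum_distrib_left by (intro sum_mono C2(2) Y)
      also have "\<dots> \<le> C2 * T powr q"
        using small C2(1) by (intro mult_left_mono) auto
      finally show ?thesis
        using C1(1) by (intro mult_left_mono add_left_mono) auto
    qed
    also have "\<dots> = D * T powr p"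
      using T(1) by (simp add: D_def powr_minus_divide)
    also have "\<dots> < 1" using T D by simp
    finally show False by simp
  qed
  then show ?thesis using T by (intro exI[of _ "T powr q"]) auto
qed

section \<open>Weights from a separation argument\<close>

lemma convergent_subseq_finitely_many:
  fixes y :: "nat \<Rightarrow> nat \<Rightarrow> real"
  assumes "\<And>n j. j < t \<Longrightarrow> \<bar>y n j\<bar> \<le> K"
  shows "\<exists>r. strict_mono r \<and> (\<forall>j<t. convergent (\<lambda>n. y (r n) j))"
  using assms
proof (induction t)
  case 0
  show ?case by (intro exI[of _ id]) (auto simp: strict_mono_def)
next
  case (Suc t)
  then obtain r where r: "strict_mono r" "\<forall>j<t. convergent (\<lambda>n. y (r n) j)"
    by (metis less_SucI)
  have "bounded (range (\<lambda>n. y (r n) t))"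
    using Suc.prems[of t] by (intro boundedI[of _ K]) auto
  then obtain l r' where r': "strict_mono r'" "((\<lambda>n. y (r n) t) \<circ> r') \<longlonglongrightarrow> l"
    using bounded_imp_convergent_subsequence by metis
  have "convergent (\<lambda>n. y ((r \<circ> r') n) j)" if "j < Suc t" for j
  proof (cases "j = t")
    case True
    then show ?thesis using r'(2) by (auto simp: convergent_def o_def)
  next
    case False
    then have "j < t" using that by simp
    then obtain l where "(\<lambda>n. y (r n) j) \<longlonglongrightarrow> l"
      using r(2) unfolding convergent_def by blast
    from LIMSEQ_subseq_LIMSEQ[OF this r'(1)] show ?thesis
      by (auto simp: convergent_def o_def)
  qed
  then show ?case using strict_mono_o[OF r(1) r'(1)] by blast
qed


text \<open>
  A minimiser \<open>y\<close> of the \<open>s\<close>-norm on the closure of the convex set \<open>C\<close> exists by compactness.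
  The gradient of the norm at \<open>y\<close>, which is \<open>y powr (s - 1)\<close> up to normalisation, has dual norm
  \<open>1\<close>, and as the norm does not decrease from \<open>y\<close> towards any \<open>z\<close> in \<open>C\<close>, the
  gradient is at least as large at \<open>z\<close> as at \<open>y\<close>. This is the separation argument behind
  Maurey's factorisation theorem.
\<close>

lemma separating_weights:
  fixes s :: real and C :: "(nat \<Rightarrow> real) set"
  assumes s: "1 \<le> s" and m: "0 < m" and "C \<noteq> {}"
    and bounds: "\<And>z j. z \<in> C \<Longrightarrow> 0 \<le> z j" "\<And>z j. z \<in> C \<Longrightarrow> j < t \<Longrightarrow> z j \<le> K"
    and convex: "\<And>y z l. y \<in> C \<Longrightarrow> z \<in> C \<Longrightarrow> 0 \<le> l \<Longrightarrow> l \<le> 1 \<Longrightarrow> (\<lambda>j. (1 - l) * y j + l * z j) \<in> C"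
    and large: "\<And>z. z \<in> C \<Longrightarrow> m \<le> (\<Sum>j<t. z j powr s)"
  shows "\<exists>\<beta>. (\<forall>j. 0 \<le> \<beta> j) \<and>
    (\<forall>w. (\<forall>j. 0 \<le> w j) \<longrightarrow> (\<Sum>j<t. \<beta> j * w j) \<le> (\<Sum>j<t. w j powr s) powr (1 / s)) \<and>
    (\<forall>z\<in>C. m powr (1 / s) \<le> (\<Sum>j<t. \<beta> j * z j))"
proof (cases "s = 1")
  case True
  \<comment> \<open>The gradient formula is not usable here, since \<open>0 powr 0 = 0\<close>.\<close>
  then show ?thesis using bounds(1) large m
    by (intro exI[of _ "\<lambda>_. 1"]) (auto simp: sum_nonneg)
next
  case False
  with s have s: "1 < s" by simp
  define F where "F z = (\<Sum>j<t. z j powr s)" for z :: "nat \<Rightarrow> real"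
  define N where "N = Inf (F ` C)"
  have bdd: "bdd_below (F ` C)" using large by (auto simp: F_def intro!: bdd_belowI2)
  have N_le: "N \<le> F z" if "z \<in> C" for z
    unfolding N_def using bdd that by (intro cInf_lower) auto
  have m_le: "m \<le> N"
    unfolding N_def using large \<open>C \<noteq> {}\<close> by (intro cInf_greatest) (auto simp: F_def)
  have "\<exists>z\<in>C. F z < N + 1 / real (Suc n)" for n
    using cInf_lessD[of "F ` C" "N + 1 / real (Suc n)"] \<open>C \<noteq> {}\<close> by (auto simp: N_def)
  then obtain Y where Y: "\<And>n. Y n \<in> C" "\<And>n. F (Y n) < N + 1 / real (Suc n)" by metis
  have "\<bar>Y n j\<bar> \<le> K" if "j < t" for n j
    using bounds[OF Y(1)] that by (auto simp: abs_of_nonneg)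
  from convergent_subseq_finitely_many[of t Y K, OF this]
  obtain r where r: "strict_mono r" "\<forall>j<t. convergent (\<lambda>n. Y (r n) j)" by blast
  define y where "y j = (if j < t then lim (\<lambda>n. Y (r n) j) else 0)" for j
  have lim: "(\<lambda>n. Y (r n) j) \<longlonglongrightarrow> y j" if "j < t" for j
    using r(2) that by (simp add: y_def convergent_LIMSEQ_iff)
  have y0: "0 \<le> y j" for j
  proof (cases "j < t")
    case True
    show ?thesis
      by (rule LIMSEQ_le_const[OF lim[OF True]]) (use bounds(1)[OF Y(1)] in blast)
  qed (simp add: y_def)
  have cont: "(\<lambda>n. F (\<lambda>j. a * Y (r n) j + b * z j)) \<longlonglongrightarrow> F (\<lambda>j. a * y j + b * z j)"
    if "0 \<le> a" "0 \<le> b" "\<And>j. 0 \<le> z j" for a b z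
    unfolding F_def
  proof (intro tendsto_sum tendsto_powr')
    fix j assume "j \<in> {..<t}"
    then have "(\<lambda>n. Y (r n) j) \<longlonglongrightarrow> y j" by (intro lim) simp
    then show "(\<lambda>n. a * Y (r n) j + b * z j) \<longlonglongrightarrow> a * y j + b * z j"
      by (intro tendsto_add tendsto_mult_left tendsto_const)
    have "0 \<le> a * Y (r n) j + b * z j" for n
      using that bounds(1)[OF Y(1)] by simp
    then show "a * y j + b * z j \<noteq> 0 \<or> 0 < s \<and> (\<forall>\<^sub>F n in sequentially. 0 \<le> a * Y (r n) j + b * z j)"
      using s by simp
  qed (rule tendsto_const)
  have Fy: "F y = N"
  proof (rule LIMSEQ_unique)
    have "(\<lambda>n. F (\<lambda>j. 1 * Y (r n) j + 0 * 0)) \<longlonglongrightarrow> F (\<lambda>j. 1 * y j + 0 * 0)"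
      by (rule cont) simp_all
    then show "(\<lambda>n. F (Y (r n))) \<longlonglongrightarrow> F y"
      by simp
    have "(\<lambda>n. F (Y n)) \<longlonglongrightarrow> N"
    proof (rule tendsto_sandwich)
      show "\<forall>\<^sub>F n in sequentially. N \<le> F (Y n)"
        using N_le[OF Y(1)] by simp
      show "\<forall>\<^sub>F n in sequentially. F (Y n) \<le> N + 1 / real (Suc n)"
        using Y(2) by (intro always_eventually allI less_imp_le)
      have "(\<lambda>n. N + 1 / real (Suc n)) \<longlonglongrightarrow> N + 0"
        by (intro tendsto_add tendsto_const LIMSEQ_inverse_real_of_nat[unfolded inverse_eq_divide])
      then show "(\<lambda>n. N + 1 / real (Suc n)) \<longlonglongrightarrow> N" by simp
    qed (rule tendsto_const)
    from LIMSEQ_subseq_LIMSEQ[OF this r(1)] show "(\<lambda>n. F (Y (r n))) \<longlonglongrightarrow> N"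
      by (simp add: o_def)
  qed
  have N0: "0 < N" using m m_le by simp
  have towards: "N \<le> F (\<lambda>j. (1 - l) * y j + l * z j)" if "z \<in> C" "0 \<le> l" "l \<le> 1" for z l
  proof (rule LIMSEQ_le_const[OF cont[of "1 - l" l z]])
    show "\<exists>M. \<forall>n\<ge>M. N \<le> F (\<lambda>j. (1 - l) * Y (r n) j + l * z j)"
      using N_le[OF convex[OF Y(1) that]] by blast
  qed (use that bounds(1)[OF that(1)] in auto)
  have gradient: "N \<le> (\<Sum>j<t. y j powr (s - 1) * z j)" if z: "z \<in> C" for z
  proof -
    have z0: "0 \<le> z j" for j using bounds(1)[OF z] .
    have step: "0 \<le> (\<Sum>j<t. ((1 - l) * y j + l * z j) powr (s - 1) * (z j - y j))"
      if l: "0 < l" "l \<le> 1" for l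
    proof -
      let ?w = "\<lambda>j. (1 - l) * y j + l * z j"
      have w0: "0 \<le> ?w j" for j using y0 z0 l by (intro add_nonneg_nonneg) auto
      have tangent: "?w j powr s - y j powr s \<le> s * l * (?w j powr (s - 1) * (z j - y j))" for j
      proof -
        have w: "?w j * ?w j powr (s - 1) = ?w j powr s"
          using w0[of j] by (subst powr_mult_base) simp_all
        have "s * (y j * ?w j powr (s - 1)) \<le> y j powr s + ?w j powr s * (s - 1)"
          using young_powr[OF y0[of j] w0[of j] s] s by (simp add: field_simps)
        then have "?w j powr s - y j powr s \<le> s * (?w j * ?w j powr (s - 1)) - s * (y j * ?w j powr (s - 1))"
          unfolding w by (simp add: algebra_simps)
        also have "\<dots> = s * ?w j powr (s - 1) * (?w j - y j)" by (simp add: algebra_simps)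
        also have "?w j - y j = l * (z j - y j)" by (simp add: algebra_simps)
        finally show ?thesis by (simp only: mult_ac)
      qed
      have "0 \<le> F ?w - F y" using towards[OF z, of l] l Fy by simp
      also have "\<dots> = (\<Sum>j<t. ?w j powr s - y j powr s)" by (simp add: F_def sum_subtractf)
      also have "\<dots> \<le> (\<Sum>j<t. s * l * (?w j powr (s - 1) * (z j - y j)))"
        by (intro sum_mono tangent)
      finally have "0 \<le> s * l * (\<Sum>j<t. ?w j powr (s - 1) * (z j - y j))"
        by (simp only: sum_distrib_left)
      moreover have "0 < s * l" using s l by simp
      ultimately show ?thesis by (simp only: zero_le_mult_iff) linarith
    qed
    have "((\<lambda>l. \<Sum>j<t. ((1 - l) * y j + l * z j) powr (s - 1) * (z j - y j))
        \<longlongrightarrow> (\<Sum>j<t. ((1 - 0) * y j + 0 * z j) powr (s - 1) * (z j - y j))) (at_right 0)"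
    proof (intro tendsto_sum tendsto_mult tendsto_powr' tendsto_add tendsto_diff tendsto_const
        tendsto_ident_at)
      fix j
      have "\<forall>\<^sub>F l in at_right 0. 0 \<le> (1 - l) * y j + l * z j"
        using y0 z0 by (intro eventually_at_rightI[of 0 1]) auto
      then show "(1 - 0) * y j + 0 * z j \<noteq> 0 \<or>
          0 < s - 1 \<and> (\<forall>\<^sub>F l in at_right 0. 0 \<le> (1 - l) * y j + l * z j)"
        using s by simp
    qed
    then have "0 \<le> (\<Sum>j<t. ((1 - 0) * y j + 0 * z j) powr (s - 1) * (z j - y j))"
      by (rule tendsto_lowerbound) (auto intro!: eventually_at_rightI[of 0 1] step)
    also have "\<dots> = (\<Sum>j<t. y j powr (s - 1) * z j) - F y"
    proof -
      have "y j powr (s - 1) * y j = y j powr s" for j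
        using y0[of j] by (subst mult.commute, subst powr_mult_base) simp_all
      then show ?thesis by (simp add: F_def right_diff_distrib sum_subtractf)
    qed
    finally show ?thesis using Fy by simp
  qed
  define \<beta> where "\<beta> j = y j powr (s - 1) / N powr ((s - 1) / s)" for j
  have "(\<Sum>j<t. \<beta> j * w j) \<le> F w powr (1 / s)" if w0: "\<And>j. 0 \<le> w j" for w
  proof (cases "F w = 0")
    case True
    then have "\<forall>j\<in>{..<t}. w j powr s = 0"
      unfolding F_def by (subst (asm) sum_nonneg_eq_0_iff) auto
    then show ?thesis by simp
  next
    case False
    define W where "W = F w powr (1 / s)"
    define M where "M = N powr (1 / s)"
    have "0 \<le> F w" by (auto simp: F_def sum_nonneg)
    then have W: "0 < W" "W powr s = F w" using False s by (auto simp: W_def powr_powr)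
    have M: "0 < M" "M powr s = N" "M powr (s - 1) = N powr ((s - 1) / s)"
      using N0 s by (auto simp: M_def powr_powr)
    have "(\<Sum>j<t. \<beta> j * w j) = W * (\<Sum>j<t. (w j / W) * (y j / M) powr (s - 1))"
      using W(1) M(1) y0 unfolding sum_distrib_left
      by (intro sum.cong) (auto simp: \<beta>_def M(3)[symmetric] powr_divide)
    also have "\<dots> \<le> W * (\<Sum>j<t. (w j / W) powr s / s + (y j / M) powr s * (s - 1) / s)"
      using W M w0 y0 s by (intro mult_left_mono sum_mono young_powr) auto
    also have "\<dots> = W * (F w / W powr s / s + F y / M powr s * (s - 1) / s)"
      using W(1) M(1) w0 y0
      by (simp add: F_def sum.distrib powr_divide sum_divide_distrib sum_distrib_right)
    also have "\<dots> = W"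
      using W M Fy N0 False s by (simp add: field_simps)
    finally show ?thesis by (simp add: W_def)
  qed
  moreover have "m powr (1 / s) \<le> (\<Sum>j<t. \<beta> j * z j)" if "z \<in> C" for z
  proof -
    have "m powr (1 / s) \<le> N powr (1 / s)"
      using m m_le s by (intro powr_mono2) auto
    also have "\<dots> = N / N powr ((s - 1) / s)"
    proof -
      have "1 / s + (s - 1) / s = 1" using s by (simp add: field_simps)
      then have "N powr (1 / s) * N powr ((s - 1) / s) = N"
        using N0 by (simp flip: powr_add)
      then show ?thesis using N0 by (simp add: eq_divide_eq)
    qed
    also have "\<dots> \<le> (\<Sum>j<t. y j powr (s - 1) * z j) / N powr ((s - 1) / s)"
      using gradient[OF that] by (intro divide_right_mono) auto
    finally show ?thesis by (simp add: \<beta>_def sum_divide_distrib)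
  qed
  ultimately show ?thesis by (intro exI[of _ \<beta>]) (auto simp: \<beta>_def F_def)
qed

lemma fun_linear_add: "Vector_Spaces.linear fscale fscale X \<Longrightarrow> X (a + b) = X a + X b"
  by (simp add: Vector_Spaces.linear_iff)

lemma fun_linear_scale: "Vector_Spaces.linear fscale fscale X \<Longrightarrow> X (fscale c a) = fscale c (X a)"
  by (simp add: Vector_Spaces.linear_iff)

lemma pnorm_square: "0 < r \<Longrightarrow> (pnorm r t x)\<^sup>2 = (\<Sum>j<t. norm (x j) powr r) powr (2 / r)"
  by (cases "(\<Sum>j<t. norm (x j) powr r) = 0")
     (auto simp: pnorm_def powr_powr simp flip: powr_numeral)

text \<open>
  The squares \<open>\<Sum>\<^sub>x \<bar>Y x\<bar>\<^sup>2\<close> over finite families with \<open>\<Sum>\<^sub>x \<parallel>X x\<parallel>\<^sub>p\<^sup>2 = 1\<close> form a convex set, because families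
  can be rescaled and concatenated. They stay away from \<open>0\<close> in the \<open>q/2\<close>-norm by the
  square function estimate, so separating weights exist; the weighted \<open>\<ell>\<^sub>2\<close>-norm of \<open>Y a\<close> then lies
  between multiples of \<open>\<parallel>X a\<parallel>\<^sub>p\<close>. This is a case of Kwapien's theorem: a space that embeds both
  into \<open>\<ell>\<^sub>p\<close> and into \<open>\<ell>\<^sub>q\<close> has cotype \<open>2\<close> and type \<open>2\<close> and is therefore Hilbertian, with a
  constant independent of its dimension.
\<close>

lemma hilbertian_weights:
  assumes p: "0 < p" "p \<le> 2" and q: "2 \<le> q" and \<delta>: "0 < \<delta>"
  shows "\<exists>c>0. \<forall>t K (X :: (nat \<Rightarrow> 'k::{real_normed_field, euclidean_space}) \<Rightarrow> nat \<Rightarrow> 'k)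
      (Y :: (nat \<Rightarrow> 'k) \<Rightarrow> nat \<Rightarrow> 'k).
    Vector_Spaces.linear fscale fscale X \<longrightarrow> Vector_Spaces.linear fscale fscale Y \<longrightarrow>
    (\<forall>a. \<delta> * pnorm p t (X a) \<le> pnorm q t (Y a)) \<longrightarrow>
    (\<forall>a. pnorm q t (Y a) \<le> K * pnorm p t (X a)) \<longrightarrow>
    (\<exists>\<beta>. (\<forall>j. 0 \<le> \<beta> j) \<and>
      (\<forall>y :: nat \<Rightarrow> 'k. (\<Sum>j<t. \<beta> j * (norm (y j))\<^sup>2) \<le> (pnorm q t y)\<^sup>2) \<and>
      (\<forall>a. c * (pnorm p t (X a))\<^sup>2 \<le> (\<Sum>j<t. \<beta> j * (norm (Y a j))\<^sup>2)))"
proof -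
  have pq: "p \<le> q" using p q by simp
  obtain m :: real where m: "0 < m" and lower_all: "\<forall>t (X :: (nat \<Rightarrow> 'k) \<Rightarrow> nat \<Rightarrow> 'k) (Y :: (nat \<Rightarrow> 'k) \<Rightarrow> nat \<Rightarrow> 'k) xs.
      (\<forall>j. Modules.additive (\<lambda>a. X a j)) \<longrightarrow> (\<forall>j. Modules.additive (\<lambda>a. Y a j)) \<longrightarrow>
      (\<forall>a. \<delta> * pnorm p t (X a) \<le> pnorm q t (Y a)) \<longrightarrow> (\<Sum>x\<leftarrow>xs. (pnorm p t (X x))\<^sup>2) = 1 \<longrightarrow>
      m \<le> (\<Sum>j<t. (\<Sum>x\<leftarrow>xs. (norm (Y x j))\<^sup>2) powr (q / 2))"
    using square_function_lower_bound[OF p pq \<delta>, where 'v = "nat \<Rightarrow> 'k" and 'k = 'k]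
    by blast
  note lower = lower_all[rule_format]
  define c where "c = m powr (1 / (q / 2))"
  have "\<exists>\<beta>. (\<forall>j. 0 \<le> \<beta> j) \<and>
      (\<forall>y :: nat \<Rightarrow> 'k. (\<Sum>j<t. \<beta> j * (norm (y j))\<^sup>2) \<le> (pnorm q t y)\<^sup>2) \<and>
      (\<forall>a. c * (pnorm p t (X a))\<^sup>2 \<le> (\<Sum>j<t. \<beta> j * (norm (Y a j))\<^sup>2))"
    if X: "Vector_Spaces.linear fscale fscale X" and Y: "Vector_Spaces.linear fscale fscale Y"
      and XY: "\<And>a. \<delta> * pnorm p t (X a) \<le> pnorm q t (Y a)"
      and YX: "\<And>a. pnorm q t (Y a) \<le> K * pnorm p t (X a)"
    for t K and X Y :: "(nat \<Rightarrow> 'k) \<Rightarrow> nat \<Rightarrow> 'k"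
  proof (cases "\<forall>a. pnorm p t (X a) = 0")
    case True
    then show ?thesis by (intro exI[of _ "\<lambda>_. 0"]) auto
  next
    case False
    then obtain a0 where a0: "pnorm p t (X a0) \<noteq> 0" by blast
    have add: "Modules.additive (\<lambda>a. X a j)" "Modules.additive (\<lambda>a. Y a j)" for j
      by (simp_all add: Modules.additive_def fun_linear_add[OF X] fun_linear_add[OF Y])
    have Y_scale: "Y (fscale u a) j = u * Y a j" for u a j
      by (simp add: fun_linear_scale[OF Y]) (simp add: fscale_def)
    define sq where "sq xs j = (\<Sum>x\<leftarrow>xs. (norm (Y x j))\<^sup>2)" for xs j
    define C where "C = {sq xs | xs. (\<Sum>x\<leftarrow>xs. (pnorm p t (X x))\<^sup>2) = 1}"
    have normalised: "sq [fscale (of_real (1 / pnorm p t (X a))) a] \<in> C" if "pnorm p t (X a) \<noteq> 0" for a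
    proof -
      have "pnorm p t (X (fscale (of_real (1 / pnorm p t (X a))) a)) = 1"
        using that p by (simp add: fun_linear_scale[OF X] pnorm_cmult norm_divide)
      then show ?thesis unfolding C_def by (intro CollectI exI conjI) auto
    qed
    have nonneg: "0 \<le> sq xs j" for xs j
      unfolding sq_def by (intro sum_list_nonneg) auto
    have bounded: "sq xs j \<le> K\<^sup>2" if "(\<Sum>x\<leftarrow>xs. (pnorm p t (X x))\<^sup>2) = 1" "j < t" for xs j
    proof -
      have "(norm (Y x j))\<^sup>2 \<le> K\<^sup>2 * (pnorm p t (X x))\<^sup>2" for x
      proof -
        have "norm (Y x j) \<le> K * pnorm p t (X x)"
          using norm_le_pnorm[of q j t "Y x"] that(2) q YX[of x] by linarith
        then have "(norm (Y x j))\<^sup>2 \<le> (K * pnorm p t (X x))\<^sup>2"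
          by (intro power_mono) auto
        then show ?thesis by (simp add: power_mult_distrib)
      qed
      then have "sq xs j \<le> (\<Sum>x\<leftarrow>xs. K\<^sup>2 * (pnorm p t (X x))\<^sup>2)"
        unfolding sq_def by (intro sum_list_mono)
      then show ?thesis by (simp add: sum_list_const_mult that(1))
    qed
    have convex: "(\<lambda>j. (1 - l) * y j + l * z j) \<in> C"
      if "y \<in> C" "z \<in> C" and l: "0 \<le> l" "l \<le> 1" for y z l
    proof -
      obtain xs ys where xs: "y = sq xs" "(\<Sum>x\<leftarrow>xs. (pnorm p t (X x))\<^sup>2) = 1"
        and ys: "z = sq ys" "(\<Sum>x\<leftarrow>ys. (pnorm p t (X x))\<^sup>2) = 1"
        using \<open>y \<in> C\<close> \<open>z \<in> C\<close> by (auto simp: C_def)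
      define scaled where "scaled u zs = map (fscale (of_real (sqrt u))) zs" for u and zs :: "(nat \<Rightarrow> 'k) list"
      have sq_scaled: "sq (scaled u zs) j = u * sq zs j" if "0 \<le> u" for u zs j
        using that
        by (induction zs) (simp_all add: sq_def scaled_def Y_scale norm_mult power_mult_distrib
            algebra_simps)
      have norm_scaled: "(\<Sum>x\<leftarrow>scaled u zs. (pnorm p t (X x))\<^sup>2) = u * (\<Sum>x\<leftarrow>zs. (pnorm p t (X x))\<^sup>2)"
        if "0 \<le> u" for u zs
        using that p
        by (induction zs) (simp_all add: scaled_def fun_linear_scale[OF X] pnorm_cmult
            power_mult_distrib algebra_simps)
      have sq_append: "sq (us @ vs) j = sq us j + sq vs j" for us vs j
        by (simp add: sq_def)
      let ?zs = "scaled (1 - l) xs @ scaled l ys"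
      have "(\<Sum>x\<leftarrow>?zs. (pnorm p t (X x))\<^sup>2) = 1"
        using l xs ys by (simp only: map_append sum_list_append norm_scaled) simp
      moreover have "(\<lambda>j. (1 - l) * y j + l * z j) = sq ?zs"
        using l xs ys by (simp add: sq_append sq_scaled fun_eq_iff)
      ultimately show ?thesis unfolding C_def by blast
    qed
    have large: "m \<le> (\<Sum>j<t. z j powr (q / 2))" if z: "z \<in> C" for z
    proof -
      obtain xs where xs: "z = sq xs" "(\<Sum>x\<leftarrow>xs. (pnorm p t (X x))\<^sup>2) = 1"
        using z by (auto simp: C_def)
      show ?thesis using lower[OF add XY xs(2)] by (simp add: xs(1) sq_def)
    qed
    have "C \<noteq> {}" using normalised[OF a0] by blast
    have "\<exists>\<beta>. (\<forall>j. 0 \<le> \<beta> j) \<and>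
      (\<forall>w. (\<forall>j. 0 \<le> w j) \<longrightarrow> (\<Sum>j<t. \<beta> j * w j) \<le> (\<Sum>j<t. w j powr (q / 2)) powr (1 / (q / 2))) \<and>
      (\<forall>z\<in>C. m powr (1 / (q / 2)) \<le> (\<Sum>j<t. \<beta> j * z j))"
    proof (rule separating_weights[OF _ m \<open>C \<noteq> {}\<close> _ _ convex large, where K = "K\<^sup>2"])
      show "1 \<le> q / 2" using q by simp
      show "0 \<le> z j" if "z \<in> C" for z j using that nonneg by (auto simp: C_def)
      show "z j \<le> K\<^sup>2" if "z \<in> C" "j < t" for z j using that bounded by (auto simp: C_def)
    qed
    then obtain \<beta> where \<beta>: "\<And>j. 0 \<le> \<beta> j"
      and upper: "\<And>w. (\<And>j. 0 \<le> w j) \<Longrightarrow> (\<Sum>j<t. \<beta> j * w j) \<le> (\<Sum>j<t. w j powr (q / 2)) powr (1 / (q / 2))"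
      and below: "\<And>z. z \<in> C \<Longrightarrow> c \<le> (\<Sum>j<t. \<beta> j * z j)"
      unfolding c_def by blast
    have half: "((u::real)\<^sup>2) powr (q / 2) = u powr q" if "0 \<le> u" for u
      using that by (cases "u = 0") (auto simp: powr_powr simp flip: powr_numeral)
    have "(\<Sum>j<t. \<beta> j * (norm (y j))\<^sup>2) \<le> (pnorm q t y)\<^sup>2" for y :: "nat \<Rightarrow> 'k"
      using upper[of "\<lambda>j. (norm (y j))\<^sup>2"] q by (simp add: half pnorm_square)
    moreover have "c * (pnorm p t (X a))\<^sup>2 \<le> (\<Sum>j<t. \<beta> j * (norm (Y a j))\<^sup>2)" for a
    proof (cases "pnorm p t (X a) = 0")
      case True
      then show ?thesis using \<beta> by (simp add: sum_nonneg)
    next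
      case False
      have "c \<le> (\<Sum>j<t. \<beta> j * (norm (Y a j))\<^sup>2) / (pnorm p t (X a))\<^sup>2"
        using below[OF normalised[OF False]]
        by (simp add: sq_def Y_scale norm_divide norm_mult power_divide
            sum_divide_distrib)
      then show ?thesis using False by (simp add: field_simps)
    qed
    ultimately show ?thesis using \<beta> by blast
  qed
  moreover have "0 < c" using m by (simp add: c_def)
  ultimately show ?thesis by blast
qed

section \<open>Conjugation, the weighted sesquilinear form and linear systems\<close>

text \<open>
  The reflection in the line of real multiples of \<open>1\<close>: complex conjugation if the scalars are
  complex, and the identity if they are real. The formula treats both cases at once.
\<close>

definition kconj :: "'k::{real_normed_field, real_inner} \<Rightarrow> 'k" where
  "kconj x = of_real (2 * (x \<bullet> 1)) - x"

lemma kconj_add: "kconj (x + y) = kconj x + kconj y"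
  by (simp add: kconj_def inner_add algebra_simps)

lemma kconj_0 [simp]: "kconj 0 = 0"
  by (simp add: kconj_def)

lemma kconj_sum: "kconj (sum f I) = (\<Sum>i\<in>I. kconj (f i))"
  by (induction I rule: infinite_finite_induct) (auto simp: kconj_add)

lemma inner_one_one: "(1::'k::{real_normed_field, real_inner}) \<bullet> 1 = 1"
  by (simp flip: power2_norm_eq_inner)

lemma of_real_inner: "(of_real r :: 'k::{real_normed_field, real_inner}) \<bullet> y = r * (1 \<bullet> y)"
  by (simp add: of_real_def)

lemma inner_of_real: "y \<bullet> (of_real r :: 'k::{real_normed_field, real_inner}) = r * (y \<bullet> 1)"
  by (simp add: of_real_def)

lemma kconj_of_real [simp]: "kconj (of_real r) = of_real r"
  by (simp add: kconj_def of_real_inner inner_one_one)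

lemma kconj_kconj [simp]: "kconj (kconj x) = x"
  by (simp add: kconj_def inner_diff of_real_inner inner_one_one del: of_real_mult)

text \<open>
  For \<open>v\<close> orthogonal to \<open>1\<close> the norms of \<open>1 + v\<close> and \<open>1 - v\<close> agree, so multiplicativity of the
  norm turns \<open>1 - v\<^sup>2\<close> into the equality case of the triangle inequality.
\<close>

lemma square_of_orthogonal_one:
  fixes v :: "'k::{real_normed_field, real_inner}"
  assumes "v \<bullet> 1 = 0"
  shows "v * v = - of_real ((norm v)\<^sup>2)"
proof -
  have n: "(norm (1 + v))\<^sup>2 = 1 + (norm v)\<^sup>2" "(norm (1 - v))\<^sup>2 = 1 + (norm v)\<^sup>2"
    using assms by (simp_all add: power2_norm_eq_inner inner_add inner_diff inner_one_one inner_commute)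
  then have "norm (1 + v) = norm (1 - v)"
    by (metis norm_ge_zero power2_eq_imp_eq)
  then have "norm (1 - v * v) = 1 + (norm v)\<^sup>2"
    using n(1) norm_mult[of "1 + v" "1 - v"] by (simp add: algebra_simps power2_eq_square)
  then have "(norm (1 - v * v))\<^sup>2 = (1 + (norm v)\<^sup>2)\<^sup>2" by simp
  moreover have "(norm (1 - v * v))\<^sup>2 = 1 - 2 * (1 \<bullet> (v * v)) + (norm (v * v))\<^sup>2"
    unfolding power2_norm_eq_inner by (simp add: inner_diff inner_one_one inner_commute)
  ultimately have "1 \<bullet> (v * v) = - (norm v)\<^sup>2"
    by (simp add: power2_sum norm_power flip: power2_eq_square power_mult)
  note one_v = this
  define z where "z = v * v"
  define r where "r = (norm v)\<^sup>2"
  have z: "1 \<bullet> z = - r" "z \<bullet> 1 = - r"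
    using one_v by (simp_all add: z_def r_def inner_commute)
  have "z \<bullet> z = r\<^sup>2"
    unfolding power2_norm_eq_inner[symmetric] by (simp add: z_def r_def norm_mult power2_eq_square)
  then have "(norm (z + of_real r))\<^sup>2 = 0"
    unfolding power2_norm_eq_inner
    by (simp add: inner_add inner_of_real of_real_inner inner_one_one z power2_eq_square)
  then have "z = - of_real r" by (simp add: eq_neg_iff_add_eq_0)
  then show ?thesis by (simp add: z_def r_def)
qed

lemma mult_kconj: "x * kconj x = of_real ((norm x)\<^sup>2)"
proof -
  define v where "v = x - of_real (x \<bullet> 1)"
  have v: "v \<bullet> 1 = 0" by (simp add: v_def inner_diff of_real_inner inner_one_one)
  then have v': "1 \<bullet> v = 0" by (simp add: inner_commute)
  have x: "x = of_real (x \<bullet> 1) + v" "kconj x = of_real (x \<bullet> 1) - v"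
    by (simp_all add: v_def kconj_def)
  have "(norm x)\<^sup>2 = (x \<bullet> 1)\<^sup>2 + (norm v)\<^sup>2"
  proof -
    have "(norm (of_real (x \<bullet> 1) + v))\<^sup>2 = (x \<bullet> 1)\<^sup>2 + (norm v)\<^sup>2"
      unfolding power2_norm_eq_inner
      by (simp add: inner_add of_real_inner inner_of_real inner_one_one v v' power2_eq_square)
    then show ?thesis by (simp flip: x(1))
  qed
  moreover have "x * kconj x = of_real ((x \<bullet> 1)\<^sup>2) - v * v"
    by (subst x(1), subst x(2)) (simp add: algebra_simps power2_eq_square)
  ultimately show ?thesis by (simp add: square_of_orthogonal_one[OF v])
qed

lemma kconj_mult: "kconj (x * y) = kconj x * kconj y"
proof (cases "x * y = 0")
  case False
  have "x * y * kconj (x * y) = (x * kconj x) * (y * kconj y)"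
    by (simp only: mult_kconj norm_mult power_mult_distrib of_real_mult)
  then show ?thesis using False by (simp add: mult_ac)
qed auto

lemma sum_mult_if_eq:
  fixes a :: "'i \<Rightarrow> 'k::semiring_1"
  assumes "finite I" "l \<in> I"
  shows "(\<Sum>i\<in>I. a i * (if i = l then 1 else 0)) = a l"
proof -
  have "(\<Sum>i\<in>I. a i * (if i = l then 1 else 0)) = (\<Sum>i\<in>I. if i = l then a i else 0)"
    by (intro sum.cong) auto
  then show ?thesis using assms by simp
qed

text \<open>The sesquilinear form that induces the Hilbert norm given by the weights \<open>\<beta>\<close>.\<close>

definition weighted_form :: "nat \<Rightarrow> (nat \<Rightarrow> real) \<Rightarrow> (nat \<Rightarrow> 'k::{real_normed_field, real_inner}) \<Rightarrow> (nat \<Rightarrow> 'k) \<Rightarrow> 'k" where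
  "weighted_form t \<beta> x y = (\<Sum>j<t. of_real (\<beta> j) * x j * kconj (y j))"

lemma weighted_form_add: "weighted_form t \<beta> (x + y) z = weighted_form t \<beta> x z + weighted_form t \<beta> y z"
  by (simp add: weighted_form_def algebra_simps sum.distrib)

lemma weighted_form_scale: "weighted_form t \<beta> (fscale c x) z = c * weighted_form t \<beta> x z"
  by (simp add: weighted_form_def fscale_def sum_distrib_left mult_ac)

lemma weighted_form_diff: "weighted_form t \<beta> (x - y) z = weighted_form t \<beta> x z - weighted_form t \<beta> y z"
  by (simp add: weighted_form_def algebra_simps sum_subtractf)

lemma weighted_form_zero: "weighted_form t \<beta> 0 z = 0"
  by (simp add: weighted_form_def)

lemma weighted_form_sum: "weighted_form t \<beta> (sum f I) z = (\<Sum>i\<in>I. weighted_form t \<beta> (f i) z)"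
  by (induction I rule: infinite_finite_induct) (simp_all only: sum.insert sum.infinite sum.empty weighted_form_add weighted_form_zero not_False_eq_True)

lemma weighted_form_commute: "weighted_form t \<beta> x y = kconj (weighted_form t \<beta> y x)"
  by (simp add: weighted_form_def kconj_sum kconj_mult mult_ac)

lemma weighted_form_self: "weighted_form t \<beta> x x = of_real (\<Sum>j<t. \<beta> j * (norm (x j))\<^sup>2)"
  by (simp add: weighted_form_def mult.assoc mult_kconj)

lemma weighted_form_self_combination:
  fixes y :: "'i \<Rightarrow> nat \<Rightarrow> 'k::{real_normed_field, real_inner}"
  assumes "finite I" and orth: "\<And>i l. i \<in> I \<Longrightarrow> l \<in> I \<Longrightarrow> weighted_form t \<beta> (y i) (y l) = (if i = l then 1 else 0)"
  shows "(\<Sum>j<t. \<beta> j * (norm ((\<Sum>i\<in>I. fscale (a i) (y i)) j))\<^sup>2) = (\<Sum>i\<in>I. (norm (a i))\<^sup>2)"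
proof -
  let ?v = "\<Sum>i\<in>I. fscale (a i) (y i)"
  have 1: "weighted_form t \<beta> ?v (y l) = a l" if "l \<in> I" for l
    using assms(1) that by (simp add: weighted_form_sum weighted_form_scale orth sum_mult_if_eq cong: sum.cong)
  have "weighted_form t \<beta> ?v ?v = (\<Sum>i\<in>I. a i * weighted_form t \<beta> (y i) ?v)"
    by (subst weighted_form_sum) (simp add: weighted_form_scale)
  also have "\<dots> = (\<Sum>i\<in>I. a i * kconj (a i))"
    by (intro sum.cong refl, subst weighted_form_commute) (simp add: 1)
  finally have "of_real (\<Sum>j<t. \<beta> j * (norm (?v j))\<^sup>2) = (of_real (\<Sum>i\<in>I. (norm (a i))\<^sup>2) :: 'k)"
    by (simp add: weighted_form_self mult_kconj)
  then show ?thesis by (simp only: of_real_eq_iff)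
qed

lemma bessel_weighted_form:
  fixes y :: "'i \<Rightarrow> nat \<Rightarrow> 'k::{real_normed_field, real_inner}"
  assumes "finite I" and \<beta>: "\<And>j. 0 \<le> \<beta> j"
    and orth: "\<And>i l. i \<in> I \<Longrightarrow> l \<in> I \<Longrightarrow> weighted_form t \<beta> (y i) (y l) = (if i = l then 1 else 0)"
  shows "(\<Sum>i\<in>I. (norm (weighted_form t \<beta> w (y i)))\<^sup>2) \<le> (\<Sum>j<t. \<beta> j * (norm (w j))\<^sup>2)"
proof -
  define c where "c i = weighted_form t \<beta> w (y i)" for i
  define v where "v = w - (\<Sum>i\<in>I. fscale (c i) (y i))"
  have 0: "weighted_form t \<beta> v (y l) = 0" if "l \<in> I" for l
    using assms(1) that by (simp add: v_def weighted_form_diff weighted_form_sum weighted_form_scale orth c_def sum_mult_if_eq cong: sum.cong)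
  have w: "w = v + (\<Sum>i\<in>I. fscale (c i) (y i))" by (simp add: v_def)
  have vc: "weighted_form t \<beta> (\<Sum>i\<in>I. fscale (c i) (y i)) v = 0"
    by (simp add: weighted_form_sum weighted_form_scale weighted_form_commute[of t \<beta> "y _"] 0)
  have "weighted_form t \<beta> w w = weighted_form t \<beta> v w + (\<Sum>i\<in>I. c i * weighted_form t \<beta> (y i) w)"
    by (subst (1) w) (simp add: weighted_form_add weighted_form_sum weighted_form_scale)
  also have "weighted_form t \<beta> v w = weighted_form t \<beta> v v"
  proof -
    have "weighted_form t \<beta> w v = weighted_form t \<beta> v v"
      by (subst w) (simp add: weighted_form_add vc)
    then show ?thesis by (metis weighted_form_commute)
  qed
  also have "(\<Sum>i\<in>I. c i * weighted_form t \<beta> (y i) w) = (\<Sum>i\<in>I. c i * kconj (c i))"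
    by (intro sum.cong refl, subst weighted_form_commute) (simp add: c_def)
  finally have "of_real (\<Sum>j<t. \<beta> j * (norm (w j))\<^sup>2)
      = (of_real ((\<Sum>j<t. \<beta> j * (norm (v j))\<^sup>2) + (\<Sum>i\<in>I. (norm (c i))\<^sup>2)) :: 'k)"
    by (simp add: weighted_form_self mult_kconj)
  then have "(\<Sum>j<t. \<beta> j * (norm (w j))\<^sup>2) = (\<Sum>j<t. \<beta> j * (norm (v j))\<^sup>2) + (\<Sum>i\<in>I. (norm (c i))\<^sup>2)"
    by (simp only: of_real_eq_iff)
  moreover have "0 \<le> (\<Sum>j<t. \<beta> j * (norm (v j))\<^sup>2)"
    using \<beta> by (intro sum_nonneg) auto
  ultimately show ?thesis by (simp add: c_def)
qed

lemma homogeneous_system_nontrivial_solution: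
  fixes M :: "nat \<Rightarrow> 'i \<Rightarrow> 'k::field"
  assumes "finite I" "m < card I"
  shows "\<exists>a. (\<exists>i\<in>I. a i \<noteq> 0) \<and> (\<forall>l<m. (\<Sum>i\<in>I. a i * M l i) = 0)"
  using assms
proof (induction m arbitrary: I M)
  case 0
  then have "I \<noteq> {}" by auto
  then show ?case by (intro exI[of _ "\<lambda>_. 1"]) auto
next
  case (Suc m)
  show ?case
  proof (cases "\<forall>i\<in>I. M m i = 0")
    case True
    obtain a where "\<exists>i\<in>I. a i \<noteq> 0" "\<forall>l<m. (\<Sum>i\<in>I. a i * M l i) = 0"
      using Suc.IH[of I M] Suc.prems by auto
    then show ?thesis using True by (intro exI[of _ a]) (auto simp: less_Suc_eq)
  next
    case False
    then obtain r where r: "r \<in> I" "M m r \<noteq> 0" by blast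
    define J where "J = I - {r}"
    have J: "finite J" "m < card J" "I = insert r J" "r \<notin> J"
      using Suc.prems r by (auto simp: J_def)
    obtain a where a: "\<exists>i\<in>J. a i \<noteq> 0"
        "\<forall>l<m. (\<Sum>i\<in>J. a i * (M l i - M m i / M m r * M l r)) = 0"
      using Suc.IH[OF J(1,2), of "\<lambda>l i. M l i - M m i / M m r * M l r"] by blast
    define a' where "a' i = (if i = r then - (\<Sum>i\<in>J. a i * M m i) / M m r else a i)" for i
    have on_J: "(\<Sum>i\<in>J. a' i * f i) = (\<Sum>i\<in>J. a i * f i)" for f
      using J(4) by (intro sum.cong) (auto simp: a'_def)
    have "(\<Sum>i\<in>I. a' i * M l i) = 0" if "l < Suc m" for l
    proof -
      have "(\<Sum>i\<in>I. a' i * M l i) = a' r * M l r + (\<Sum>i\<in>J. a i * M l i)"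
        using J by (simp add: on_J)
      also have "\<dots> = (\<Sum>i\<in>J. a i * (M l i - M m i / M m r * M l r))"
        by (simp add: a'_def algebra_simps sum_subtractf sum_distrib_right sum_distrib_left
            sum_divide_distrib)
      also have "\<dots> = 0"
        using a(2) that r(2) by (cases "l = m") auto
      finally show ?thesis .
    qed
    moreover have "\<exists>i\<in>I. a' i \<noteq> 0" using a(1) J by (auto simp: a'_def)
    ultimately show ?thesis by blast
  qed
qed

section \<open>Sequence spaces and bounded operators\<close>

lemma sum_fun_apply: "sum f I x = (\<Sum>i\<in>I. f i x)"
  by (induction I rule: infinite_finite_induct) auto

lemma ell_vectors_iff: "x \<in> vectors (ell r) \<longleftrightarrow> summable (\<lambda>i. norm (x i) powr r)"
  by (simp add: ell_def)

lemma vnorm_ell_nonneg [simp]: "0 \<le> vnorm (ell r) x"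
  by (simp add: ell_def)

lemma vnorm_ell_powr:
  "0 < r \<Longrightarrow> x \<in> vectors (ell r) \<Longrightarrow> vnorm (ell r) x powr r = (\<Sum>i. norm (x i) powr r)"
  by (simp add: ell_def powr_powr suminf_nonneg)

lemma ell_vectors_bounded_by:
  assumes "summable f" "\<And>j. norm (x j) powr r \<le> f j"
  shows "x \<in> vectors (ell r)"
  unfolding ell_vectors_iff using assms by (intro summable_comparison_test[OF _ assms(1)]) auto

lemma norm_add_powr_le:
  fixes x y :: "'k::real_normed_vector"
  assumes "0 < r"
  shows "norm (x + y) powr r \<le> 2 powr r * (norm x powr r + norm y powr r)"
proof -
  have "norm (x + y) powr r \<le> (\<Sum>i\<in>{True, False}. if i then norm x else norm y) powr r"
    using assms by (intro powr_mono2) (auto simp: norm_triangle_ineq)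
  also have "\<dots> \<le> real (card {True, False}) powr r * (\<Sum>i\<in>{True, False}. (if i then norm x else norm y) powr r)"
    using assms by (intro powr_sum_le_sum_powr) auto
  finally show ?thesis by simp
qed

lemma ell_vectors_add:
  assumes "0 < r" "x \<in> vectors (ell r)" "y \<in> vectors (ell r)"
  shows "x + y \<in> vectors (ell r)"
proof (rule ell_vectors_bounded_by)
  show "summable (\<lambda>j. 2 powr r * (norm (x j) powr r + norm (y j) powr r))"
    using assms by (intro summable_mult summable_add) (simp_all add: ell_vectors_iff)
qed (simp add: norm_add_powr_le[OF assms(1)])

lemma ell_vectors_scale:
  "x \<in> vectors (ell r) \<Longrightarrow> fscale c x \<in> vectors (ell r)"
  by (simp add: ell_vectors_iff fscale_def norm_mult powr_mult summable_mult)

lemma ell_vectors_finite_support: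
  assumes "\<And>j. t \<le> j \<Longrightarrow> x j = 0"
  shows "x \<in> vectors (ell r)"
  unfolding ell_vectors_iff using assms by (intro summable_finite[of "{..<t}"]) auto

lemma ell_vectors_zero: "0 \<in> vectors (ell r)"
  by (rule ell_vectors_finite_support) simp

lemma ell_vectors_sum:
  assumes "0 < r" "\<And>i. i \<in> I \<Longrightarrow> f i \<in> vectors (ell r)"
  shows "sum f I \<in> vectors (ell r)"
  using assms(2)
proof (induction I rule: infinite_finite_induct)
  case (insert i I)
  have "f i + sum f I \<in> vectors (ell r)"
    by (intro ell_vectors_add assms(1) insert.prems insert.IH) (use insert.prems in auto)
  then show ?case by (simp only: sum.insert[OF insert.hyps])
qed (simp_all only: sum.infinite sum.empty ell_vectors_zero not_False_eq_True)

lemma vnorm_ell_scale: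
  assumes "0 < r" "x \<in> vectors (ell r)"
  shows "vnorm (ell r) (fscale c x) = norm c * vnorm (ell r) x"
  using assms
  by (simp add: ell_def fscale_def norm_mult powr_mult suminf_mult powr_powr suminf_nonneg)

lemma pnorm_le_vnorm_ell:
  assumes "0 < r" "x \<in> vectors (ell r)"
  shows "pnorm r t x \<le> vnorm (ell r) x"
  using assms unfolding pnorm_def ell_def
  by (auto intro!: powr_mono2 sum_nonneg sum_le_suminf)

lemma vnorm_ell_finite_support:
  assumes "\<And>j. t \<le> j \<Longrightarrow> x j = 0"
  shows "vnorm (ell r) x = pnorm r t x"
proof -
  have "(\<Sum>j. norm (x j) powr r) = (\<Sum>j<t. norm (x j) powr r)"
    using assms by (intro suminf_finite) auto
  then show ?thesis by (simp add: ell_def pnorm_def)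
qed

lemma norm_le_vnorm_ell:
  assumes "0 < r" "x \<in> vectors (ell r)"
  shows "norm (x j) \<le> vnorm (ell r) x"
  using norm_le_pnorm[OF assms(1), of j "Suc j" x] pnorm_le_vnorm_ell[OF assms, of "Suc j"] by simp

lemma bounded_ops_maps: "S \<in> bounded_ops X Y \<Longrightarrow> x \<in> vectors X \<Longrightarrow> S x \<in> vectors Y"
  by (simp add: bounded_ops_def)

lemma bounded_ops_add:
  "S \<in> bounded_ops X Y \<Longrightarrow> x \<in> vectors X \<Longrightarrow> y \<in> vectors X \<Longrightarrow> S (x + y) = S x + S y"
  by (simp add: bounded_ops_def)

lemma bounded_ops_scale:
  "S \<in> bounded_ops X Y \<Longrightarrow> x \<in> vectors X \<Longrightarrow> S (fscale c x) = fscale c (S x)"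
  by (simp add: bounded_ops_def)

lemma fscale_zero_left: "fscale 0 x = 0"
  by (simp add: fscale_def zero_fun_def)

lemma bounded_ops_ell_zero: "S \<in> bounded_ops (ell r) Y \<Longrightarrow> S 0 = 0"
  using bounded_ops_scale[of S "ell r" Y 0 0] ell_vectors_zero by (metis fscale_zero_left)

lemma bounded_ops_ell_combination:
  assumes "0 < r" "S \<in> bounded_ops (ell r) Y" "\<And>i. i \<in> I \<Longrightarrow> u i \<in> vectors (ell r)"
  shows "S (\<Sum>i\<in>I. fscale (a i) (u i)) = (\<Sum>i\<in>I. fscale (a i) (S (u i)))"
  using assms(3)
proof (induction I rule: infinite_finite_induct)
  case (insert i I)
  have mem: "u i \<in> vectors (ell r)" "(\<Sum>i\<in>I. fscale (a i) (u i)) \<in> vectors (ell r)"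
    using insert.prems by (auto intro!: ell_vectors_sum ell_vectors_scale assms(1))
  have "S (fscale (a i) (u i) + (\<Sum>i\<in>I. fscale (a i) (u i)))
      = fscale (a i) (S (u i)) + (\<Sum>i\<in>I. fscale (a i) (S (u i)))"
    using mem insert.IH[OF insert.prems[OF insertI2]]
    by (simp only: bounded_ops_add[OF assms(2)] ell_vectors_scale bounded_ops_scale[OF assms(2)] insertCI)
  then show ?case by (simp only: sum.insert[OF insert.hyps])
qed (simp_all only: sum.infinite sum.empty bounded_ops_ell_zero[OF assms(2)] not_False_eq_True)

lemma bounded_ops_positive_bound:
  assumes "S \<in> bounded_ops X Y" "\<And>x. x \<in> vectors X \<Longrightarrow> 0 \<le> vnorm X x"
  shows "\<exists>C>0. \<forall>x\<in>vectors X. vnorm Y (S x) \<le> C * vnorm X x"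
proof -
  obtain C where C: "\<And>x. x \<in> vectors X \<Longrightarrow> vnorm Y (S x) \<le> C * vnorm X x"
    using assms(1) unfolding bounded_ops_def by blast
  have "vnorm Y (S x) \<le> max C 1 * vnorm X x" if "x \<in> vectors X" for x
    using C[OF that] mult_right_mono[of C "max C 1", OF _ assms(2)[OF that]] by simp
  then show ?thesis by (intro exI[of _ "max C 1"]) auto
qed

text \<open>
  Biorthogonal points bound the coefficients of a linear combination by its norm, with a
  constant that does not depend on the space.
\<close>

lemma biorthogonal_points:
  fixes E :: "('i \<Rightarrow> 'k::field) set"
  assumes E: "fun_vs.subspace E" and "k \<le> fun_vs.dim E"
  shows "\<exists>u J. (\<forall>i<k. u i \<in> E) \<and> (\<forall>i<k. \<forall>l<k. u i (J l) = (if i = l then 1 else 0))"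
  using assms(2)
proof (induction k)
  case 0
  show ?case by simp
next
  case (Suc k)
  then have "k \<le> fun_vs.dim E" by simp
  from Suc.IH[OF this] obtain u J where u: "\<forall>i<k. u i \<in> E"
    and J: "\<forall>i<k. \<forall>l<k. u i (J l) = (if i = l then 1 else 0)"
    by blast
  have "\<not> E \<subseteq> fun_vs.span (u ` {..<k})"
  proof
    assume "E \<subseteq> fun_vs.span (u ` {..<k})"
    then have "fun_vs.dim E \<le> card (u ` {..<k})" by (intro fun_vs.dim_le_card) auto
    also have "\<dots> \<le> k" using card_image_le[of "{..<k}" u] by simp
    finally show False using Suc.prems by simp
  qed
  then obtain x where x: "x \<in> E" "x \<notin> fun_vs.span (u ` {..<k})" by blast
  define w where "w = (\<Sum>i<k. fscale (x (J i)) (u i))"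
  have w: "w \<in> fun_vs.span (u ` {..<k})" "w \<in> E"
    unfolding w_def using u
    by (intro fun_vs.span_sum fun_vs.span_scale fun_vs.span_base, simp,
        intro fun_vs.subspace_sum[OF E] fun_vs.subspace_scale[OF E], simp)
  have "x - w \<noteq> 0" using x(2) w(1) by auto
  then obtain j0 where j0: "(x - w) j0 \<noteq> 0" by (auto simp: fun_eq_iff)
  have wJ: "w (J l) = x (J l)" if "l < k" for l
  proof -
    have "w (J l) = (\<Sum>i<k. x (J i) * u i (J l))"
      by (simp add: w_def fscale_def sum_fun_apply)
    also have "\<dots> = (\<Sum>i<k. if i = l then x (J i) else 0)"
      using that by (intro sum.cong) (auto simp: J)
    finally show ?thesis using that by simp
  qed
  define v where "v = fscale (1 / (x - w) j0) (x - w)"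
  have vE: "v \<in> E"
    unfolding v_def by (intro fun_vs.subspace_scale fun_vs.subspace_diff E x w)
  have v: "v j0 = 1" "\<And>l. l < k \<Longrightarrow> v (J l) = 0"
    using j0 wJ by (simp_all add: v_def fscale_def)
  define u' where "u' i = (if i < k then u i - fscale (u i j0) v else v)" for i
  define J' where "J' l = (if l < k then J l else j0)" for l
  have "u' i \<in> E" if "i < Suc k" for i
    unfolding u'_def using vE u by (auto intro!: fun_vs.subspace_diff[OF E] fun_vs.subspace_scale[OF E])
  moreover have "u' i (J' l) = (if i = l then 1 else 0)" if "i < Suc k" "l < Suc k" for i l
    using that v J by (auto simp: u'_def J'_def fscale_def less_Suc_eq)
  ultimately show ?case by blast
qed

lemma not_finitely_strictly_singular_lower_bound:
  fixes R :: "(nat \<Rightarrow> 'k::{real_normed_field, euclidean_space}) \<Rightarrow> nat \<Rightarrow> 'k"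
  assumes p: "0 < p" and q: "0 < q" and R: "R \<in> bounded_ops (ell p) (ell q)"
    and not_fss: "\<not> finitely_strictly_singular (ell p) (ell q) R"
  shows "\<exists>\<epsilon>>0. \<forall>n\<ge>1. \<exists>E\<subseteq>vectors (ell p). fun_vs.subspace E \<and> fun_vs.dim E = n \<and>
    (\<forall>x\<in>E. \<epsilon> * vnorm (ell p) x \<le> vnorm (ell q) (R x))"
proof -
  obtain \<epsilon> where \<epsilon>: "0 < \<epsilon>" and E: "\<forall>n\<ge>1. \<exists>E. (E \<subseteq> vectors (ell p) \<and> fun_vs.subspace E \<and>
      fun_vs.dim E = n) \<and> \<not> (INF x\<in>{x \<in> E. vnorm (ell p) x = 1}. vnorm (ell q) (R x)) < \<epsilon>"
    using not_fss unfolding finitely_strictly_singular_def by (simp only: not_all not_ex not_imp) blast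
  have "\<epsilon> * vnorm (ell p) x \<le> vnorm (ell q) (R x)"
    if E: "E \<subseteq> vectors (ell p)" "fun_vs.subspace E" and x: "x \<in> E"
      and inf: "\<epsilon> \<le> (INF x\<in>{x \<in> E. vnorm (ell p) x = 1}. vnorm (ell q) (R x))" for E x
  proof (cases "vnorm (ell p) x = 0")
    case False
    define c where "c = vnorm (ell p) x"
    have c: "0 < c" using False vnorm_ell_nonneg[of p x] unfolding c_def by linarith
    let ?y = "fscale (of_real (1 / c)) x"
    have mem: "x \<in> vectors (ell p)" using E x by blast
    have y: "?y \<in> {x \<in> E. vnorm (ell p) x = 1}"
      using x c fun_vs.subspace_scale[OF E(2) x] vnorm_ell_scale[OF p mem, of "of_real (1 / c)"]
      by (simp add: norm_divide flip: c_def)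
    have "(INF x\<in>{x \<in> E. vnorm (ell p) x = 1}. vnorm (ell q) (R x)) \<le> vnorm (ell q) (R ?y)"
      using y by (intro cINF_lower) (auto intro!: bdd_belowI2[of _ 0])
    then have "\<epsilon> \<le> vnorm (ell q) (R ?y)" using inf by linarith
    then show ?thesis
      using c mem q
      by (simp add: bounded_ops_scale[OF R] vnorm_ell_scale bounded_ops_maps[OF R] norm_divide c_def
          field_simps)
  qed simp
  note lower = this
  show ?thesis
  proof (intro exI[of _ \<epsilon>] conjI allI impI \<epsilon>)
    fix n :: nat assume "1 \<le> n"
    with E obtain E where "E \<subseteq> vectors (ell p)" "fun_vs.subspace E" "fun_vs.dim E = n"
        "\<epsilon> \<le> (INF x\<in>{x \<in> E. vnorm (ell p) x = 1}. vnorm (ell q) (R x))"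
      by (meson not_less)
    then show "\<exists>E\<subseteq>vectors (ell p). fun_vs.subspace E \<and> fun_vs.dim E = n \<and>
        (\<forall>x\<in>E. \<epsilon> * vnorm (ell p) x \<le> vnorm (ell q) (R x))"
      using lower by blast
  qed
qed

section \<open>Truncation of subspaces\<close>

lemma powr_le_cancel_base:
  fixes x y :: real
  assumes "0 < r" "0 \<le> y" "x powr r \<le> y powr r"
  shows "x \<le> y"
  using powr_less_mono2[OF assms(1,2), of x] assms(3) by linarith

definition trunc :: "nat \<Rightarrow> (nat \<Rightarrow> 'k::zero) \<Rightarrow> nat \<Rightarrow> 'k" where
  "trunc t x = (\<lambda>j. if j < t then x j else 0)"

definition cut_below :: "nat \<Rightarrow> (nat \<Rightarrow> 'k::zero) \<Rightarrow> nat \<Rightarrow> 'k" where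
  "cut_below t x = (\<lambda>j. if j < t then 0 else x j)"

lemma trunc_plus_cut_below: "trunc t x + cut_below t x = x" for x :: "nat \<Rightarrow> 'k::monoid_add"
  by (auto simp: trunc_def cut_below_def)

lemma cut_below_sums:
  fixes f :: "nat \<Rightarrow> real"
  assumes "summable f"
  shows "(\<lambda>j. if j < t then 0 else f j) sums (suminf f - (\<Sum>j<t. f j))"
proof -
  have "(\<lambda>j. if j \<in> {..<t} then f j else 0) sums (\<Sum>j<t. f j)"
    by (rule sums_If_finite_set) simp
  from sums_diff[OF summable_sums[OF assms] this]
  have "(\<lambda>j. f j - (if j \<in> {..<t} then f j else 0)) sums (suminf f - (\<Sum>j<t. f j))" .
  moreover have "(\<lambda>j. f j - (if j \<in> {..<t} then f j else 0)) = (\<lambda>j. if j < t then 0 else f j)"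
    by (simp add: fun_eq_iff)
  ultimately show ?thesis by simp
qed

lemma ell_vectors_trunc: "trunc t x \<in> vectors (ell r)"
  by (rule ell_vectors_finite_support[of t]) (simp add: trunc_def)

lemma ell_vectors_cut_below: "x \<in> vectors (ell r) \<Longrightarrow> cut_below t x \<in> vectors (ell r)"
  by (rule ell_vectors_bounded_by[of "\<lambda>j. norm (x j) powr r"])
     (auto simp: ell_vectors_iff cut_below_def)

lemma vnorm_ell_split:
  assumes "0 < r" "x \<in> vectors (ell r)"
  shows "vnorm (ell r) x powr r = pnorm r t x powr r + vnorm (ell r) (cut_below t x) powr r"
proof -
  have sm: "summable (\<lambda>j. norm (x j) powr r)" using assms by (simp add: ell_vectors_iff)
  have "(\<lambda>j. norm (cut_below t x j) powr r) = (\<lambda>j. if j < t then 0 else norm (x j) powr r)"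
    by (auto simp: cut_below_def)
  then have "vnorm (ell r) (cut_below t x) powr r = (\<Sum>j. norm (x j) powr r) - (\<Sum>j<t. norm (x j) powr r)"
    using sums_unique[OF cut_below_sums[OF sm, of t]] assms
    by (simp add: vnorm_ell_powr ell_vectors_cut_below)
  then show ?thesis using assms by (simp add: vnorm_ell_powr pnorm_powr)
qed

lemma ell_tail_tendsto:
  assumes "0 < r" "x \<in> vectors (ell r)"
  shows "(\<lambda>t. vnorm (ell r) (cut_below t x) powr r) \<longlonglongrightarrow> 0"
proof -
  have "(\<lambda>t. vnorm (ell r) x powr r - (\<Sum>j<t. norm (x j) powr r)) \<longlonglongrightarrow> vnorm (ell r) x powr r - vnorm (ell r) x powr r"
    using assms by (intro tendsto_diff tendsto_const) (simp add: vnorm_ell_powr ell_vectors_iff summable_LIMSEQ)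
  moreover have "vnorm (ell r) x powr r - (\<Sum>j<t. norm (x j) powr r) = vnorm (ell r) (cut_below t x) powr r" for t
    using vnorm_ell_split[OF assms, of t] assms(1) by (simp add: pnorm_powr)
  ultimately show ?thesis by simp
qed

text \<open>
  The crude bound \<open>(\<Sum>i<n. b i) powr r \<le> n powr r * (\<Sum>i<n. b i powr r)\<close> replaces Minkowski's
  inequality; its constant is harmless because the tails tend to \<open>0\<close> for fixed \<open>n\<close>.
\<close>

lemma uniformly_small_tails:
  fixes u :: "nat \<Rightarrow> nat \<Rightarrow> 'k::{real_normed_field, euclidean_space}"
  assumes r: "0 < r" and u: "\<And>i. i < N \<Longrightarrow> u i \<in> vectors (ell r)" and \<eta>: "0 < \<eta>"
  shows "\<exists>t0. \<forall>t\<ge>t0. \<forall>a A. (\<forall>i<N. norm (a i) \<le> A) \<longrightarrow>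
    vnorm (ell r) (\<Sum>i<N. fscale (a i) (cut_below t (u i))) powr r \<le> \<eta> * A powr r"
proof -
  let ?T = "\<lambda>t. real N powr r * (\<Sum>i<N. vnorm (ell r) (cut_below t (u i)) powr r)"
  have "?T \<longlonglongrightarrow> real N powr r * (\<Sum>i<N. 0)"
    using r u by (intro tendsto_mult_left tendsto_sum ell_tail_tendsto) auto
  then have "\<forall>\<^sub>F t in sequentially. ?T t < \<eta>"
    using \<eta> by (intro order_tendstoD(2)) auto
  then obtain t0 where t0: "\<And>t. t0 \<le> t \<Longrightarrow> ?T t < \<eta>"
    by (auto simp: eventually_sequentially)
  have "vnorm (ell r) (\<Sum>i<N. fscale (a i) (cut_below t (u i))) powr r \<le> \<eta> * A powr r"
    if t: "t0 \<le> t" and a: "\<forall>i<N. norm (a i) \<le> A" for t a A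
  proof -
    let ?w = "\<lambda>i. cut_below t (u i)"
    have w: "?w i \<in> vectors (ell r)" if "i < N" for i
      using u[OF that] by (rule ell_vectors_cut_below)
    have sw: "summable (\<lambda>j. norm (?w i j) powr r)" if "i < N" for i
      using w[OF that] by (simp add: ell_vectors_iff)
    have pointwise: "norm ((\<Sum>i<N. fscale (a i) (?w i)) j) powr r
        \<le> real N powr r * (\<Sum>i<N. A powr r * norm (?w i j) powr r)" for j
    proof -
      have "norm ((\<Sum>i<N. fscale (a i) (?w i)) j) powr r \<le> (\<Sum>i<N. norm (a i) * norm (?w i j)) powr r"
        using r by (intro powr_mono2)
          (auto simp: sum_fun_apply fscale_def norm_mult intro!: order_trans[OF norm_sum])
      also have "\<dots> \<le> real (card {..<N}) powr r * (\<Sum>i<N. (norm (a i) * norm (?w i j)) powr r)"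
        using r by (intro powr_sum_le_sum_powr) auto
      also have "\<dots> \<le> real N powr r * (\<Sum>i<N. A powr r * norm (?w i j) powr r)"
        unfolding powr_mult card_lessThan using a r
        by (intro mult_left_mono sum_mono mult_right_mono powr_mono2) auto
      finally show ?thesis .
    qed
    have "vnorm (ell r) (\<Sum>i<N. fscale (a i) (?w i)) powr r
        = (\<Sum>j. norm ((\<Sum>i<N. fscale (a i) (?w i)) j) powr r)"
      using r w by (intro vnorm_ell_powr ell_vectors_sum ell_vectors_scale) auto
    also have "\<dots> \<le> (\<Sum>j. real N powr r * (\<Sum>i<N. A powr r * norm (?w i j) powr r))"
    proof (rule suminf_le[OF pointwise])
      have "(\<Sum>i<N. fscale (a i) (?w i)) \<in> vectors (ell r)"
        using r w by (intro ell_vectors_sum ell_vectors_scale) auto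
      then show "summable (\<lambda>j. norm ((\<Sum>i<N. fscale (a i) (?w i)) j) powr r)"
        by (simp only: ell_vectors_iff)
      show "summable (\<lambda>j. real N powr r * (\<Sum>i<N. A powr r * norm (?w i j) powr r))"
        using sw by (intro summable_mult summable_sum) auto
    qed
    also have "\<dots> = real N powr r * (\<Sum>i<N. A powr r * (\<Sum>j. norm (?w i j) powr r))"
    proof (rule sums_unique[symmetric], intro sums_mult sums_sum)
      show "(\<lambda>j. norm (?w i j) powr r) sums (\<Sum>j. norm (?w i j) powr r)" if "i \<in> {..<N}" for i
        using sw that by (intro summable_sums) simp
    qed
    also have "\<dots> = ?T t * A powr r"
      using r w by (simp add: vnorm_ell_powr sum_distrib_left sum_distrib_right mult_ac)
    also have "\<dots> \<le> \<eta> * A powr r"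
      using t0[OF t] by (intro mult_right_mono) auto
    finally show ?thesis .
  qed
  then show ?thesis by blast
qed

text \<open>
  On a finite-dimensional subspace the parts cut off are uniformly small, so they cannot destroy
  the lower bound of \<open>R\<close>. The vectors are truncated first and the coordinates of the images
  afterwards, so that all later conditions can be imposed on exactly finitely supported vectors.
\<close>

lemma truncated_lower_bound:
  fixes R :: "(nat \<Rightarrow> 'k::{real_normed_field, euclidean_space}) \<Rightarrow> nat \<Rightarrow> 'k"
  assumes p: "1 \<le> p" and q: "1 \<le> q" and R: "R \<in> bounded_ops (ell p) (ell q)"
    and C: "0 < C" "\<And>x. x \<in> vectors (ell p) \<Longrightarrow> vnorm (ell q) (R x) \<le> C * vnorm (ell p) x"
    and \<epsilon>: "0 < \<epsilon>"
    and E: "fun_vs.subspace E" "E \<subseteq> vectors (ell p)" "N \<le> fun_vs.dim E"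
      "\<And>x. x \<in> E \<Longrightarrow> \<epsilon> * vnorm (ell p) x \<le> vnorm (ell q) (R x)"
  shows "\<exists>v t. s < t \<and> (\<forall>i<N. \<forall>j\<ge>t. v i j = 0) \<and>
    (\<forall>a. \<epsilon> / 8 * pnorm p t (\<Sum>i<N. fscale (a i) (v i)) \<le> pnorm q t (R (\<Sum>i<N. fscale (a i) (v i)))) \<and>
    (\<forall>a. (\<exists>i<N. a i \<noteq> 0) \<longrightarrow> 0 < pnorm p t (\<Sum>i<N. fscale (a i) (v i)))"
proof -
  have p0: "0 < p" and q0: "0 < q" using p q by auto
  obtain u J where u_all: "\<forall>i<N. u i \<in> E"
    and J_all: "\<forall>i<N. \<forall>l<N. u i (J l) = (if i = l then 1 else 0)"
    using biorthogonal_points[OF E(1,3)] by blast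
  have uE: "u i \<in> E" and u: "u i \<in> vectors (ell p)" if "i < N" for i
    using u_all E(2) that by auto
  \<comment> \<open>The constant makes \<open>R\<close> send the discarded part of a vector to at most a quarter of the lower bound.\<close>
  define \<kappa> where "\<kappa> = \<epsilon> / (4 * C)"
  have \<kappa>: "0 < \<kappa>" using \<epsilon> C by (simp add: \<kappa>_def)
  have "\<exists>t1. \<forall>t\<ge>t1. \<forall>a A. (\<forall>i<N. norm (a i) \<le> A) \<longrightarrow>
      vnorm (ell p) (\<Sum>i<N. fscale (a i) (cut_below t (u i))) powr p \<le> \<kappa> powr p * A powr p"
    using p0 u \<kappa> by (intro uniformly_small_tails) auto
  then obtain t1 where t1: "\<forall>t\<ge>t1. \<forall>a A. (\<forall>i<N. norm (a i) \<le> A) \<longrightarrow>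
      vnorm (ell p) (\<Sum>i<N. fscale (a i) (cut_below t (u i))) powr p \<le> \<kappa> powr p * A powr p" ..
  define v where "v i = trunc t1 (u i)" for i
  have v: "v i \<in> vectors (ell p)" for i unfolding v_def by (rule ell_vectors_trunc)
  have Rv: "R (v i) \<in> vectors (ell q)" for i using v by (rule bounded_ops_maps[OF R])
  define \<eta> where "\<eta> = \<epsilon> powr q / (4 * 2 powr q)"
  have \<eta>: "0 < \<eta>" using \<epsilon> by (simp add: \<eta>_def)
  have "\<exists>t2. \<forall>t\<ge>t2. \<forall>a A. (\<forall>i<N. norm (a i) \<le> A) \<longrightarrow>
      vnorm (ell q) (\<Sum>i<N. fscale (a i) (cut_below t (R (v i)))) powr q \<le> \<eta> * A powr q"
    using q0 Rv \<eta> by (intro uniformly_small_tails) auto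
  then obtain t2 where t2: "\<forall>t\<ge>t2. \<forall>a A. (\<forall>i<N. norm (a i) \<le> A) \<longrightarrow>
      vnorm (ell q) (\<Sum>i<N. fscale (a i) (cut_below t (R (v i)))) powr q \<le> \<eta> * A powr q" ..
  define t where "t = Suc (s + t1 + t2)"
  have v0: "v i j = 0" if "t \<le> j" for i j using that by (simp add: v_def trunc_def t_def)
  define X where "X a = (\<Sum>i<N. fscale (a i) (v i))" for a
  define x where "x a = (\<Sum>i<N. fscale (a i) (u i))" for a
  have X: "X a \<in> vectors (ell p)" for a
    unfolding X_def using p0 v by (intro ell_vectors_sum ell_vectors_scale) auto
  have xE: "x a \<in> E" for a
    unfolding x_def using uE by (intro fun_vs.subspace_sum[OF E(1)] fun_vs.subspace_scale[OF E(1)]) auto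
  then have x: "x a \<in> vectors (ell p)" for a using E(2) by auto
  have X0: "X a j = 0" if "t \<le> j" for a j
    using v0[OF that] by (simp add: X_def sum_fun_apply fscale_def)
  have RX: "R (X a) = (\<Sum>i<N. fscale (a i) (R (v i)))" for a
    unfolding X_def using v by (intro bounded_ops_ell_combination[OF p0 R]) auto
  have coeff: "norm (a i) \<le> vnorm (ell p) (x a)" if "i < N" for a i
  proof -
    have "x a (J i) = (\<Sum>l<N. a l * (if l = i then 1 else 0))"
      unfolding x_def sum_fun_apply fscale_def using J_all that by (intro sum.cong) auto
    then have "x a (J i) = a i" using that by (simp add: sum_mult_if_eq)
    then show ?thesis using norm_le_vnorm_ell[OF p0 x, of a "J i"] by simp
  qed
  have X_le_x: "pnorm p t (X a) \<le> vnorm (ell p) (x a)" for a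
  proof -
    have "norm (X a j) \<le> norm (x a j)" for j
      by (cases "j < t1") (auto simp: X_def x_def v_def trunc_def sum_fun_apply fscale_def)
    then have "pnorm p t (X a) \<le> pnorm p t (x a)"
      unfolding pnorm_def using p0 by (intro powr_mono2 sum_mono sum_nonneg) auto
    also have "\<dots> \<le> vnorm (ell p) (x a)" by (rule pnorm_le_vnorm_ell[OF p0 x])
    finally show ?thesis .
  qed
  have main: "\<epsilon> / 8 * vnorm (ell p) (x a) \<le> pnorm q t (R (X a))" for a
  proof -
    define A where "A = vnorm (ell p) (x a)"
    have A0: "0 \<le> A" by (simp add: A_def)
    have aA: "\<forall>i<N. norm (a i) \<le> A" using coeff by (simp add: A_def)
    define d where "d = (\<Sum>i<N. fscale (a i) (cut_below t1 (u i)))"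
    have d: "d \<in> vectors (ell p)"
      unfolding d_def using p0 u by (intro ell_vectors_sum ell_vectors_scale ell_vectors_cut_below) auto
    have xXd: "x a = X a + d"
      unfolding x_def X_def d_def v_def
      by (simp only: trunc_plus_cut_below flip: sum.distrib fun_vs.scale_right_distrib)
    have "vnorm (ell p) d powr p \<le> \<kappa> powr p * A powr p"
      unfolding d_def by (rule t1[rule_format]) (use aA in auto)
    moreover have "\<kappa> powr p * A powr p = (\<kappa> * A) powr p"
      by (simp add: powr_mult)
    ultimately have "vnorm (ell p) d powr p \<le> (\<kappa> * A) powr p" by simp
    then have "vnorm (ell p) d \<le> \<kappa> * A"
      by (rule powr_le_cancel_base[OF p0, rotated]) (use \<kappa> A0 in simp)
    then have "C * vnorm (ell p) d \<le> C * (\<kappa> * A)" using C(1) by simp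
    also have "\<dots> = \<epsilon> / 4 * A" using C(1) by (simp add: \<kappa>_def)
    finally have Rd: "vnorm (ell q) (R d) \<le> \<epsilon> / 4 * A"
      using C(2)[OF d] by linarith
    have RX_mem: "R (X a) \<in> vectors (ell q)" "R d \<in> vectors (ell q)" "R (x a) \<in> vectors (ell q)"
      using X d x by (auto intro: bounded_ops_maps[OF R])
    have "(\<epsilon> * A) powr q \<le> vnorm (ell q) (R (x a)) powr q"
      using E(4)[OF xE, of a] \<epsilon> q0 A0 unfolding A_def by (intro powr_mono2) auto
    also have "\<dots> \<le> 2 powr q * (vnorm (ell q) (R (X a)) powr q + vnorm (ell q) (R d) powr q)"
    proof -
      have eq: "R (x a) j = R (X a) j + R d j" for j
        using bounded_ops_add[OF R X d, of a] by (simp add: xXd)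
      have sm: "summable (\<lambda>j. norm (R (X a) j) powr q)" "summable (\<lambda>j. norm (R d j) powr q)"
          "summable (\<lambda>j. norm (R (x a) j) powr q)"
        using RX_mem by (simp_all only: ell_vectors_iff)
      have "(\<Sum>j. norm (R (x a) j) powr q)
          \<le> (\<Sum>j. 2 powr q * (norm (R (X a) j) powr q + norm (R d j) powr q))"
        using sm by (intro suminf_le summable_mult summable_add) (auto simp: eq norm_add_powr_le[OF q0])
      also have "\<dots> = 2 powr q * ((\<Sum>j. norm (R (X a) j) powr q) + (\<Sum>j. norm (R d j) powr q))"
        using sm by (simp add: suminf_mult suminf_add summable_add)
      finally show ?thesis using q0 RX_mem by (simp add: vnorm_ell_powr)
    qed
    also have "vnorm (ell q) (R (X a)) powr q
        = pnorm q t (R (X a)) powr q + vnorm (ell q) (cut_below t (R (X a))) powr q"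
      by (rule vnorm_ell_split[OF q0 RX_mem(1)])
    finally have 1: "(\<epsilon> * A) powr q \<le> 2 powr q * (pnorm q t (R (X a)) powr q
        + vnorm (ell q) (cut_below t (R (X a))) powr q + vnorm (ell q) (R d) powr q)" .
    have "cut_below t (R (X a)) = (\<Sum>i<N. fscale (a i) (cut_below t (R (v i))))"
      by (auto simp: RX fun_eq_iff cut_below_def sum_fun_apply fscale_def)
    then have 2: "vnorm (ell q) (cut_below t (R (X a))) powr q \<le> \<eta> * A powr q"
      using t2 aA by (simp add: t_def)
    have 3: "vnorm (ell q) (R d) powr q \<le> (\<epsilon> / 4 * A) powr q"
      using Rd q0 by (intro powr_mono2) auto
    have half: "2 powr q * (\<epsilon> / 4 * A) powr q \<le> (\<epsilon> * A) powr q / 2"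
    proof -
      have "2 powr q * (\<epsilon> / 4 * A) powr q = (1 / 2) powr q * (\<epsilon> * A) powr q"
        by (simp add: mult_ac flip: powr_mult)
      also have "\<dots> \<le> (1 / 2) powr 1 * (\<epsilon> * A) powr q"
        using q by (intro mult_right_mono powr_mono') auto
      finally show ?thesis by simp
    qed
    have quarter: "2 powr q * (\<eta> * A powr q) = (\<epsilon> * A) powr q / 4"
      using A0 \<epsilon> by (simp add: \<eta>_def powr_mult)
    have "2 powr q * (pnorm q t (R (X a)) powr q + vnorm (ell q) (cut_below t (R (X a))) powr q
          + vnorm (ell q) (R d) powr q)
        \<le> 2 powr q * (pnorm q t (R (X a)) powr q + \<eta> * A powr q + (\<epsilon> / 4 * A) powr q)"
      by (intro mult_left_mono add_mono 2 3) auto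
    also have "\<dots> = 2 powr q * pnorm q t (R (X a)) powr q
        + 2 powr q * (\<eta> * A powr q) + 2 powr q * (\<epsilon> / 4 * A) powr q"
      by (simp only: distrib_left)
    finally have "(\<epsilon> * A) powr q \<le> 2 powr q * pnorm q t (R (X a)) powr q
        + 2 powr q * (\<eta> * A powr q) + 2 powr q * (\<epsilon> / 4 * A) powr q"
      by (rule order_trans[OF 1])
    then have fourth: "(\<epsilon> * A) powr q / 4 \<le> 2 powr q * pnorm q t (R (X a)) powr q"
      using half quarter by linarith
    have "(\<epsilon> / 8 * A) powr q \<le> pnorm q t (R (X a)) powr q"
    proof -
      have "2 powr q * (\<epsilon> / 8 * A) powr q = (1 / 4) powr q * (\<epsilon> * A) powr q"
        by (simp add: mult_ac flip: powr_mult)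
      also have "\<dots> \<le> (1 / 4) powr 1 * (\<epsilon> * A) powr q"
        using q by (intro mult_right_mono powr_mono') auto
      also have "\<dots> \<le> 2 powr q * pnorm q t (R (X a)) powr q"
        using fourth by simp
      finally show ?thesis by simp
    qed
    then show ?thesis
      unfolding A_def by (rule powr_le_cancel_base[OF q0 pnorm_nonneg])
  qed
  have "0 < pnorm p t (X a)" if "i < N" "a i \<noteq> 0" for a i
  proof (rule ccontr)
    assume "\<not> 0 < pnorm p t (X a)"
    then have "vnorm (ell p) (X a) = 0"
      using vnorm_ell_finite_support[of t "X a" p, OF X0] pnorm_nonneg[of p t "X a"] by linarith
    then have "vnorm (ell q) (R (X a)) \<le> 0" using C(2)[OF X, of a] by simp
    then have "pnorm q t (R (X a)) \<le> 0"
      using pnorm_le_vnorm_ell[OF q0 bounded_ops_maps[OF R X], of t a] by simp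
    moreover have "0 < \<epsilon> / 8 * vnorm (ell p) (x a)"
      using order_less_le_trans[OF _ coeff[OF that(1), of a], of 0] that(2) \<epsilon> by simp
    ultimately show False using main[of a] by linarith
  qed
  moreover have "\<epsilon> / 8 * pnorm p t (X a) \<le> pnorm q t (R (X a))" for a
    by (rule order_trans[OF mult_left_mono[OF X_le_x] main]) (use \<epsilon> in simp)
  moreover have "s < t" by (simp add: t_def)
  ultimately show ?thesis using v0 unfolding X_def by blast
qed

section \<open>Hilbertian blocks\<close>

lemma linear_fscaleI:
  assumes "\<And>x y. X (x + y) = X x + X y" "\<And>c x. X (fscale c x) = fscale c (X x)"
  shows "Vector_Spaces.linear fscale fscale X"
  using assms by (simp add: Vector_Spaces.linear_iff fun_vs.vector_space_axioms)

lemma fun_linear_combination: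
  assumes X: "Vector_Spaces.linear fscale fscale X"
  shows "X (\<Sum>i\<in>I. fscale (a i) (e i)) = (\<Sum>i\<in>I. fscale (a i) (X (e i)))"
proof -
  have "X 0 = 0" using fun_linear_scale[OF X, of 0 0] by (simp only: fscale_zero_left)
  then show ?thesis
    by (induction I rule: infinite_finite_induct)
       (simp_all only: sum.infinite sum.empty sum.insert fun_linear_add[OF X] fun_linear_scale[OF X]
         not_False_eq_True)
qed

lemma combination_linear:
  fixes v :: "nat \<Rightarrow> nat \<Rightarrow> 'k::field"
  shows "Vector_Spaces.linear fscale fscale (\<lambda>a. \<Sum>i<N. fscale (a i) (v i))"
proof (rule linear_fscaleI)
  show "(\<Sum>i<N. fscale ((x + y) i) (v i)) = (\<Sum>i<N. fscale (x i) (v i)) + (\<Sum>i<N. fscale (y i) (v i))"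
    for x y :: "nat \<Rightarrow> 'k"
    by (simp only: plus_fun_apply fun_vs.scale_left_distrib sum.distrib)
  show "(\<Sum>i<N. fscale (fscale c x i) (v i)) = fscale c (\<Sum>i<N. fscale (x i) (v i))"
    for c and x :: "nat \<Rightarrow> 'k"
    by (simp only: fun_vs.scale_sum_right fun_vs.scale_scale fscale_def[of c x])
qed

lemma homogeneous_list_nontrivial_solution:
  fixes L :: "(nat \<Rightarrow> 'k::field) list"
  assumes "length L < N"
  shows "\<exists>a. (\<exists>i<N. a i \<noteq> 0) \<and> (\<forall>f\<in>set L. (\<Sum>i<N. a i * f i) = 0)"
proof -
  obtain a where "\<exists>i\<in>{..<N}. a i \<noteq> 0" "\<forall>l<length L. (\<Sum>i<N. a i * (L ! l) i) = 0"
    using homogeneous_system_nontrivial_solution[of "{..<N}" "length L" "\<lambda>l. L ! l"] assms by auto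
  then show ?thesis by (intro exI[of _ a]) (auto simp: in_set_conv_nth)
qed

text \<open>
  A copy of \<open>\<ell>\<^sub>2\<^sup>h\<close>, spanned by the \<open>f i\<close>, on which \<open>R\<close> is inverted by the functionals \<open>g i\<close>. Two of
  the conditions serve to combine blocks: the \<open>g i\<close> annihilate \<open>Z\<close>, which stands for the images of
  earlier blocks, and the \<open>R (f i)\<close> vanish below \<open>s\<close>, where the functionals of earlier blocks live.
\<close>

definition hilbert_block ::
  "real \<Rightarrow> real \<Rightarrow> ((nat \<Rightarrow> 'k::{real_normed_field, euclidean_space}) \<Rightarrow> nat \<Rightarrow> 'k) \<Rightarrow> real
    \<Rightarrow> nat \<Rightarrow> nat \<Rightarrow> nat \<Rightarrow> (nat \<Rightarrow> 'k) list \<Rightarrow> (nat \<Rightarrow> nat \<Rightarrow> 'k) \<Rightarrow> (nat \<Rightarrow> nat \<Rightarrow> 'k) \<Rightarrow> bool" where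
  "hilbert_block p q R c h s t Z f g \<longleftrightarrow> s < t \<and>
     (\<forall>i<h. \<forall>j. j \<notin> {s..<t} \<longrightarrow> f i j = 0) \<and>
     (\<forall>i<h. \<forall>j<s. R (f i) j = 0) \<and>
     (\<forall>i<h. \<forall>l<h. (\<Sum>j\<in>{s..<t}. g i j * R (f l) j) = (if i = l then 1 else 0)) \<and>
     (\<forall>i<h. \<forall>z\<in>set Z. (\<Sum>j\<in>{s..<t}. g i j * z j) = 0) \<and>
     (\<forall>a. pnorm p t (\<Sum>i<h. fscale (a i) (f i)) \<le> c * L2_set (\<lambda>i. norm (a i)) {..<h}) \<and>
     (\<forall>y. L2_set (\<lambda>i. norm (\<Sum>j\<in>{s..<t}. g i j * y j)) {..<h} powr q
            \<le> (\<Sum>j\<in>{s..<t}. norm (y j) powr q))"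

text \<open>
  In a subspace of large dimension on which \<open>R\<close> is bounded below, the images are orthonormalised
  with respect to the Hilbert norm given by the weights, within the kernel of the finitely many
  functionals that have to vanish. The lower estimate of the weights bounds combinations of the
  \<open>f i\<close>; the upper estimate and Bessel's inequality bound the coefficient functionals \<open>g i\<close>. The
  constant depends neither on \<open>h\<close> nor on \<open>s\<close> and \<open>Z\<close>.
\<close>

lemma hilbert_block_exists:
  fixes R :: "(nat \<Rightarrow> 'k::{real_normed_field, euclidean_space}) \<Rightarrow> nat \<Rightarrow> 'k"
  assumes p: "1 < p" "p \<le> 2" and q: "2 \<le> q" and R: "R \<in> bounded_ops (ell p) (ell q)"
    and not_fss: "\<not> finitely_strictly_singular (ell p) (ell q) R"
  shows "\<exists>c>0. \<forall>h s Z. \<exists>t f g. hilbert_block p q R c h s t Z f g"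
proof -
  have p0: "0 < p" and q0: "0 < q" using p q by auto
  obtain C where C: "0 < C" "\<forall>x\<in>vectors (ell p). vnorm (ell q) (R x) \<le> C * vnorm (ell p) x"
    using bounded_ops_positive_bound[OF R] by auto
  obtain \<epsilon> where \<epsilon>: "0 < \<epsilon>" and large_subspace:
      "\<forall>n\<ge>1. \<exists>E\<subseteq>vectors (ell p). fun_vs.subspace E \<and> fun_vs.dim E = n \<and>
         (\<forall>x\<in>E. \<epsilon> * vnorm (ell p) x \<le> vnorm (ell q) (R x))"
    using not_finitely_strictly_singular_lower_bound[OF p0 q0 R not_fss] by (elim exE conjE)
  have \<delta>: "0 < \<epsilon> / 8" using \<epsilon> by simp
  obtain c0 :: real where c0: "0 < c0" and weights:
    "\<forall>t K (X :: (nat \<Rightarrow> 'k) \<Rightarrow> nat \<Rightarrow> 'k) (Y :: (nat \<Rightarrow> 'k) \<Rightarrow> nat \<Rightarrow> 'k).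
    Vector_Spaces.linear fscale fscale X \<longrightarrow> Vector_Spaces.linear fscale fscale Y \<longrightarrow>
    (\<forall>a. \<epsilon> / 8 * pnorm p t (X a) \<le> pnorm q t (Y a)) \<longrightarrow>
    (\<forall>a. pnorm q t (Y a) \<le> K * pnorm p t (X a)) \<longrightarrow>
    (\<exists>\<beta>. (\<forall>j. 0 \<le> \<beta> j) \<and>
      (\<forall>y :: nat \<Rightarrow> 'k. (\<Sum>j<t. \<beta> j * (norm (y j))\<^sup>2) \<le> (pnorm q t y)\<^sup>2) \<and>
      (\<forall>a. c0 * (pnorm p t (X a))\<^sup>2 \<le> (\<Sum>j<t. \<beta> j * (norm (Y a j))\<^sup>2)))"
    using hilbertian_weights[OF p0 p(2) q \<delta>, where 'k = 'k] by (elim exE conjE)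
  define c where "c = 1 / sqrt c0"
  have "\<exists>t f g. hilbert_block p q R c h s t Z f g" for h s and Z :: "(nat \<Rightarrow> 'k) list"
  proof -
    \<comment> \<open>More than the \<open>2 * s + length Z\<close> conditions in \<open>good\<close> and the orthogonality to fewer than \<open>h\<close> vectors.\<close>
    define N where "N = Suc (2 * s + length Z + h)"
    have "1 \<le> N" by (simp add: N_def)
    with large_subspace obtain E where E: "E \<subseteq> vectors (ell p)" "fun_vs.subspace E" "fun_vs.dim E = N"
        "\<forall>x\<in>E. \<epsilon> * vnorm (ell p) x \<le> vnorm (ell q) (R x)"
      by (elim allE[of _ N] impE) auto
    have "\<exists>v t. s < t \<and> (\<forall>i<N. \<forall>j\<ge>t. v i j = 0) \<and>
      (\<forall>a. \<epsilon> / 8 * pnorm p t (\<Sum>i<N. fscale (a i) (v i)) \<le> pnorm q t (R (\<Sum>i<N. fscale (a i) (v i)))) \<and>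
      (\<forall>a. (\<exists>i<N. a i \<noteq> 0) \<longrightarrow> 0 < pnorm p t (\<Sum>i<N. fscale (a i) (v i)))"
      using p q C E \<epsilon> by (intro truncated_lower_bound[OF _ _ R, where C = C and E = E]) auto
    then obtain v t where st: "s < t" and v0: "\<forall>i<N. \<forall>j\<ge>t. v i j = 0"
      and lower: "\<forall>a. \<epsilon> / 8 * pnorm p t (\<Sum>i<N. fscale (a i) (v i)) \<le> pnorm q t (R (\<Sum>i<N. fscale (a i) (v i)))"
      and pos: "\<forall>a. (\<exists>i<N. a i \<noteq> 0) \<longrightarrow> 0 < pnorm p t (\<Sum>i<N. fscale (a i) (v i))"
      by (elim exE conjE)
    define X where "X a = (\<Sum>i<N. fscale (a i) (v i))" for a
    define Y where "Y a = R (X a)" for a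
    have v: "v i \<in> vectors (ell p)" if "i < N" for i
      using v0 that by (intro ell_vectors_finite_support[of t]) auto
    have X_mem: "X a \<in> vectors (ell p)" for a
      unfolding X_def using p0 v by (intro ell_vectors_sum ell_vectors_scale) auto
    have X0: "X a j = 0" if "t \<le> j" for a j
      using v0 that by (simp add: X_def sum_fun_apply fscale_def)
    have X_linear: "Vector_Spaces.linear fscale fscale X"
      unfolding X_def by (rule combination_linear)
    have Y_linear: "Vector_Spaces.linear fscale fscale Y"
      unfolding Y_def
      by (rule linear_fscaleI) (simp_all only: fun_linear_add[OF X_linear] fun_linear_scale[OF X_linear]
          bounded_ops_add[OF R X_mem X_mem] bounded_ops_scale[OF R X_mem])
    have Y_combination: "Y a = (\<Sum>i<N. fscale (a i) (R (v i)))" for a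
      unfolding Y_def X_def using v by (intro bounded_ops_ell_combination[OF p0 R]) auto
    have upper: "pnorm q t (Y a) \<le> C * pnorm p t (X a)" for a
    proof -
      have "pnorm q t (Y a) \<le> vnorm (ell q) (Y a)"
        unfolding Y_def by (intro pnorm_le_vnorm_ell q0 bounded_ops_maps[OF R] X_mem)
      also have "\<dots> \<le> C * vnorm (ell p) (X a)" unfolding Y_def using C(2) X_mem by blast
      also have "vnorm (ell p) (X a) = pnorm p t (X a)"
        by (rule vnorm_ell_finite_support[OF X0])
      finally show ?thesis .
    qed
    have XY: "\<epsilon> / 8 * pnorm p t (X a) \<le> pnorm q t (Y a)" for a
      using lower unfolding X_def Y_def by blast
    obtain \<beta> where \<beta>_all: "\<forall>j. 0 \<le> \<beta> j"
        "\<forall>y :: nat \<Rightarrow> 'k. (\<Sum>j<t. \<beta> j * (norm (y j))\<^sup>2) \<le> (pnorm q t y)\<^sup>2"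
        "\<forall>a. c0 * (pnorm p t (X a))\<^sup>2 \<le> (\<Sum>j<t. \<beta> j * (norm (Y a j))\<^sup>2)"
      using weights[rule_format, OF X_linear Y_linear XY upper] by (elim exE conjE)
    note \<beta> = \<beta>_all(1)[rule_format] and \<beta>_upper = \<beta>_all(2)[rule_format]
      and \<beta>_lower = \<beta>_all(3)[rule_format]
    define good where "good a \<longleftrightarrow> (\<forall>j<s. X a j = 0 \<and> Y a j = 0) \<and> (\<forall>z\<in>set Z. weighted_form t \<beta> (Y a) z = 0)" for a
    \<comment> \<open>Gram--Schmidt inside the common kernel of the functionals that \<open>good\<close> prescribes\<close>
    have "\<exists>e. (\<forall>i<k. good (e i)) \<and>
        (\<forall>i<k. \<forall>l<k. weighted_form t \<beta> (Y (e i)) (Y (e l)) = (if i = l then 1 else 0))" if "k \<le> h" for k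
      using that
    proof (induction k)
      case (Suc k)
      then obtain e where e: "\<forall>i<k. good (e i)"
        and orth: "\<forall>i<k. \<forall>l<k. weighted_form t \<beta> (Y (e i)) (Y (e l)) = (if i = l then 1 else 0)"
        by auto
      define L where "L = map (\<lambda>j i. v i j) [0..<s] @ map (\<lambda>j i. R (v i) j) [0..<s]
        @ map (\<lambda>z i. weighted_form t \<beta> (R (v i)) z) (Z @ map (\<lambda>l. Y (e l)) [0..<k])"
      have "length L < N" using Suc.prems by (simp add: L_def N_def)
      from homogeneous_list_nontrivial_solution[OF this] obtain a
        where a: "\<exists>i<N. a i \<noteq> 0" and kernel: "\<forall>f\<in>set L. (\<Sum>i<N. a i * f i) = 0" by blast
      have wY: "weighted_form t \<beta> (Y a) z = (\<Sum>i<N. a i * weighted_form t \<beta> (R (v i)) z)" for z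
        by (simp add: Y_combination weighted_form_sum weighted_form_scale)
      have a_good: "good a"
        using kernel unfolding good_def wY
        by (auto simp: L_def X_def Y_combination sum_fun_apply fscale_def)
      have a_orth: "weighted_form t \<beta> (Y a) (Y (e l)) = 0" if "l < k" for l
        using kernel that unfolding wY by (auto simp: L_def)
      define w where "w = (\<Sum>j<t. \<beta> j * (norm (Y a j))\<^sup>2)"
      have "0 < pnorm p t (X a)" using pos a unfolding X_def by blast
      with c0 have "0 < c0 * (pnorm p t (X a))\<^sup>2" by (intro mult_pos_pos zero_less_power)
      then have w: "0 < w" using \<beta>_lower[of a] unfolding w_def by linarith
      define r where "r = (of_real (1 / sqrt w) :: 'k)"
      define e' where "e' = e(k := fscale r a)"
      have Yr: "Y (fscale r a) = fscale r (Y a)" and Xr: "X (fscale r a) = fscale r (X a)"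
        by (rule fun_linear_scale[OF Y_linear], rule fun_linear_scale[OF X_linear])
      have "good (fscale r a)"
        using a_good unfolding good_def Yr Xr weighted_form_scale by (simp add: fscale_def)
      then have "\<forall>i<Suc k. good (e' i)" using e by (simp add: e'_def less_Suc_eq)
      moreover have "weighted_form t \<beta> (Y (fscale r a)) (Y (fscale r a)) = 1"
      proof -
        have "weighted_form t \<beta> (fscale r (Y a)) (fscale r (Y a)) = r * kconj (r * weighted_form t \<beta> (Y a) (Y a))"
          by (simp add: weighted_form_scale weighted_form_commute[of t \<beta> "Y a" "fscale r (Y a)"])
        also have "\<dots> = of_real (1 / sqrt w * (1 / sqrt w * w))"
          unfolding r_def weighted_form_self w_def[symmetric] by (simp only: of_real_mult[symmetric] kconj_of_real)
        also have "1 / sqrt w * (1 / sqrt w * w) = 1" using w by (simp add: field_simps)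
        finally show ?thesis by (simp add: Yr)
      qed
      moreover have "weighted_form t \<beta> (Y (fscale r a)) (Y (e l)) = 0"
          "weighted_form t \<beta> (Y (e l)) (Y (fscale r a)) = 0" if "l < k" for l
        using a_orth[OF that] weighted_form_commute[of t \<beta> "Y (e l)" "Y (fscale r a)"]
        by (simp_all add: Yr weighted_form_scale)
      ultimately show ?case
        using orth by (intro exI[of _ e']) (auto simp: e'_def less_Suc_eq)
    qed simp
    then obtain e where e: "\<forall>i<h. good (e i)"
      and orth: "\<forall>i<h. \<forall>l<h. weighted_form t \<beta> (Y (e i)) (Y (e l)) = (if i = l then 1 else 0)"
      by blast
    define f where "f i = X (e i)" for i
    define g where "g i j = of_real (\<beta> j) * kconj (Y (e i) j)" for i j
    have g_eq: "(\<Sum>j\<in>{s..<t}. g i j * y j) = weighted_form t \<beta> y (Y (e i))" if "i < h" for i y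
    proof -
      have "weighted_form t \<beta> y (Y (e i)) = (\<Sum>j\<in>{s..<t}. of_real (\<beta> j) * y j * kconj (Y (e i) j))"
        unfolding weighted_form_def using e that by (intro sum.mono_neutral_right) (auto simp: good_def)
      then show ?thesis by (simp add: g_def mult_ac)
    qed
    have "hilbert_block p q R c h s t Z f g"
      unfolding hilbert_block_def
    proof (intro conjI allI impI ballI st)
      fix i j assume "i < h" "j \<notin> {s..<t}"
      then show "f i j = 0" using e X0[of j "e i"] by (cases "t \<le> j") (auto simp: f_def good_def)
    next
      fix i j assume "i < h" "j < s"
      then show "R (f i) j = 0" using e by (simp add: f_def good_def Y_def)
    next
      fix i l assume "i < h" "l < h"
      then show "(\<Sum>j\<in>{s..<t}. g i j * R (f l) j) = (if i = l then 1 else 0)"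
        using orth g_eq[of i "Y (e l)"] by (simp add: f_def Y_def)
    next
      fix i z assume "i < h" "z \<in> set Z"
      then show "(\<Sum>j\<in>{s..<t}. g i j * z j) = 0"
        using e weighted_form_commute[of t \<beta> z "Y (e i)"] by (simp add: g_eq good_def)
    next
      fix a :: "nat \<Rightarrow> 'k"
      let ?b = "\<Sum>i<h. fscale (a i) (e i)"
      have "(\<Sum>i<h. fscale (a i) (f i)) = X ?b"
        unfolding f_def by (rule fun_linear_combination[OF X_linear, symmetric])
      moreover have "c0 * (pnorm p t (X ?b))\<^sup>2 \<le> (\<Sum>i<h. (norm (a i))\<^sup>2)"
      proof -
        have "(\<Sum>j<t. \<beta> j * (norm (Y ?b j))\<^sup>2) = (\<Sum>i<h. (norm (a i))\<^sup>2)"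
          unfolding fun_linear_combination[OF Y_linear]
          using orth by (intro weighted_form_self_combination) auto
        then show ?thesis using \<beta>_lower[of ?b] by simp
      qed
      then have "sqrt (c0 * (pnorm p t (X ?b))\<^sup>2) \<le> L2_set (\<lambda>i. norm (a i)) {..<h}"
        unfolding L2_set_def by (rule real_sqrt_le_mono)
      then have "pnorm p t (X ?b) \<le> c * L2_set (\<lambda>i. norm (a i)) {..<h}"
        using c0 by (simp add: c_def real_sqrt_mult field_simps)
      ultimately show "pnorm p t (\<Sum>i<h. fscale (a i) (f i)) \<le> c * L2_set (\<lambda>i. norm (a i)) {..<h}"
        by simp
    next
      fix y :: "nat \<Rightarrow> 'k"
      let ?y = "cut_below s y"
      have cut: "(\<Sum>j\<in>{s..<t}. g i j * y j) = weighted_form t \<beta> ?y (Y (e i))" if "i < h" for i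
        using g_eq[OF that, of ?y] by (auto simp: cut_below_def)
      have "(\<Sum>i<h. (norm (weighted_form t \<beta> ?y (Y (e i))))\<^sup>2) \<le> (\<Sum>j<t. \<beta> j * (norm (?y j))\<^sup>2)"
        using orth by (intro bessel_weighted_form \<beta>) auto
      also have "\<dots> \<le> (pnorm q t ?y)\<^sup>2" by (rule \<beta>_upper)
      finally have "L2_set (\<lambda>i. norm (weighted_form t \<beta> ?y (Y (e i)))) {..<h} \<le> pnorm q t ?y"
        unfolding L2_set_def by (intro real_le_lsqrt) (auto simp: sum_nonneg)
      moreover have "L2_set (\<lambda>i. norm (\<Sum>j\<in>{s..<t}. g i j * y j)) {..<h}
          = L2_set (\<lambda>i. norm (weighted_form t \<beta> ?y (Y (e i)))) {..<h}"
        by (intro L2_set_cong) (auto simp: cut)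
      ultimately have "L2_set (\<lambda>i. norm (\<Sum>j\<in>{s..<t}. g i j * y j)) {..<h} powr q \<le> pnorm q t ?y powr q"
        using q0 by (intro powr_mono2) (auto simp: L2_set_nonneg)
      also have "\<dots> = (\<Sum>j<t. norm (?y j) powr q)" by (rule pnorm_powr[OF q0])
      also have "\<dots> = (\<Sum>j\<in>{s..<t}. norm (y j) powr q)"
        by (intro sum.mono_neutral_cong_right) (auto simp: cut_below_def)
      finally show "L2_set (\<lambda>i. norm (\<Sum>j\<in>{s..<t}. g i j * y j)) {..<h} powr q
          \<le> (\<Sum>j\<in>{s..<t}. norm (y j) powr q)" .
    qed
    then show ?thesis by blast
  qed
  moreover have "0 < c" using c0 by (simp add: c_def)
  ultimately show ?thesis by blast
qed

section \<open>Gluing the blocks\<close>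

text \<open>
  Each block starts where the previous one ends and takes the images of all earlier blocks as its
  \<open>Z\<close>. The blocks are thereby biorthogonal to each other exactly, not only up to small errors.
\<close>

lemma hilbert_block_sequence:
  fixes R :: "(nat \<Rightarrow> 'k::{real_normed_field, euclidean_space}) \<Rightarrow> nat \<Rightarrow> 'k"
  assumes p: "1 < p" "p \<le> 2" and q: "2 \<le> q" and R: "R \<in> bounded_ops (ell p) (ell q)"
    and not_fss: "\<not> finitely_strictly_singular (ell p) (ell q) R"
  shows "\<exists>c>0. \<exists>s f g. s 0 = 0 \<and> strict_mono s \<and>
    (\<forall>n. \<forall>i<n. \<forall>j. j \<notin> {s n..<s (Suc n)} \<longrightarrow> f n i j = 0) \<and>
    (\<forall>n. \<forall>i<n. \<forall>m. \<forall>l<m. (\<Sum>j\<in>{s n..<s (Suc n)}. g n i j * R (f m l) j)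
        = (if n = m \<and> i = l then 1 else 0)) \<and>
    (\<forall>n a. pnorm p (s (Suc n)) (\<Sum>i<n. fscale (a i) (f n i)) \<le> c * L2_set (\<lambda>i. norm (a i)) {..<n}) \<and>
    (\<forall>n y. L2_set (\<lambda>i. norm (\<Sum>j\<in>{s n..<s (Suc n)}. g n i j * y j)) {..<n} powr q
        \<le> (\<Sum>j\<in>{s n..<s (Suc n)}. norm (y j) powr q))"
proof -
  obtain c where c: "0 < c" and "\<forall>h s Z. \<exists>t f g. hilbert_block p q R c h s t Z f g"
    using hilbert_block_exists[OF assms] by blast
  then obtain T F G where block: "\<And>h s Z. hilbert_block p q R c h s (T h s Z) Z (F h s Z) (G h s Z)"
    by metis
  define state where "state = rec_nat (0 :: nat, [] :: (nat \<Rightarrow> 'k) list)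
    (\<lambda>n sZ. (T n (fst sZ) (snd sZ), snd sZ @ map (\<lambda>l. R (F n (fst sZ) (snd sZ) l)) [0..<n]))"
  define s where "s n = fst (state n)" for n
  define Z where "Z n = snd (state n)" for n
  define f where "f n = F n (s n) (Z n)" for n
  define g where "g n = G n (s n) (Z n)" for n
  have s_Suc: "s (Suc n) = T n (s n) (Z n)" for n by (simp add: s_def Z_def state_def)
  have Z_Suc: "Z (Suc n) = Z n @ map (\<lambda>l. R (f n l)) [0..<n]" for n
    by (simp add: s_def Z_def f_def state_def)
  have blk: "hilbert_block p q R c n (s n) (s (Suc n)) (Z n) (f n) (g n)" for n
    unfolding s_Suc f_def g_def by (rule block)
  have s0: "s 0 = 0" by (simp add: s_def state_def)
  have mono: "strict_mono s"
    using blk unfolding hilbert_block_def strict_mono_Suc_iff by blast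
  have Z_member: "R (f m l) \<in> set (Z n)" if "m < n" "l < m" for m n l
    using that by (induction n) (auto simp: Z_Suc less_Suc_eq)
  note props = blk[unfolded hilbert_block_def]
  have biorth: "(\<Sum>j\<in>{s n..<s (Suc n)}. g n i j * R (f m l) j) = (if n = m \<and> i = l then 1 else 0)"
    if "i < n" "l < m" for n m i l
  proof -
    consider "m < n" | "m = n" | "n < m" by linarith
    then show ?thesis
    proof cases
      case 1
      have "R (f m l) \<in> set (Z n)" using Z_member 1 that by blast
      with props[of n] that(1) have "(\<Sum>j\<in>{s n..<s (Suc n)}. g n i j * R (f m l) j) = 0" by blast
      then show ?thesis using 1 by simp
    next
      case 2
      then show ?thesis using props[of n] that by simp
    next
      case 3
      then have le: "s (Suc n) \<le> s m" using mono by (simp add: strict_mono_less_eq)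
      have zero: "\<forall>j<s m. R (f m l) j = 0" using props[of m] \<open>l < m\<close> by blast
      have "(\<Sum>j\<in>{s n..<s (Suc n)}. g n i j * R (f m l) j) = 0"
        using le zero by (intro sum.neutral) auto
      then show ?thesis using 3 by simp
    qed
  qed
  show ?thesis
  proof (rule exI[of _ c], rule conjI[OF c], rule exI[of _ s], rule exI[of _ f], rule exI[of _ g],
      intro conjI s0 mono allI impI biorth)
    show "f n i j = 0" if "i < n" "j \<notin> {s n..<s (Suc n)}" for n i j
      using props[of n] that by blast
    show "pnorm p (s (Suc n)) (\<Sum>i<n. fscale (a i) (f n i)) \<le> c * L2_set (\<lambda>i. norm (a i)) {..<n}" for n a
      using props[of n] by blast
    show "L2_set (\<lambda>i. norm (\<Sum>j\<in>{s n..<s (Suc n)}. g n i j * y j)) {..<n} powr q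
        \<le> (\<Sum>j\<in>{s n..<s (Suc n)}. norm (y j) powr q)" for n y
      using props[of n] by blast
  qed
qed

lemma sum_over_blocks:
  fixes h :: "nat \<Rightarrow> 'b::comm_monoid_add"
  assumes "s 0 = 0" "strict_mono s"
  shows "(\<Sum>j<s M. h j) = (\<Sum>n<M. \<Sum>j\<in>{s n..<s (Suc n)}. h j)"
proof (induction M)
  case (Suc M)
  have "(\<Sum>j<s (Suc M). h j) = (\<Sum>j<s M. h j) + (\<Sum>j\<in>{s M..<s (Suc M)}. h j)"
    using strict_mono_less_eq[OF assms(2), of M "Suc M"]
    by (simp flip: atLeast0LessThan add: sum.atLeastLessThan_concat)
  then show ?case by (simp add: Suc.IH)
qed (simp add: assms(1))

lemma vnorm_ell2n_sum_nonneg [simp]: "0 \<le> vnorm (ell2n_sum r) x"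
  by (simp add: ell2n_sum_def)

lemma vnorm_ell2n_sum_powr:
  "0 < r \<Longrightarrow> x \<in> vectors (ell2n_sum r) \<Longrightarrow> vnorm (ell2n_sum r) x powr r = (\<Sum>n. block_norm x n powr r)"
  by (simp add: ell2n_sum_def powr_powr suminf_nonneg)

lemma bounded_ops_compose:
  assumes S: "S \<in> bounded_ops X Y" and S': "S' \<in> bounded_ops Y Z"
    and nonneg: "\<And>y. 0 \<le> vnorm Y y"
  shows "(\<lambda>x. S' (S x)) \<in> bounded_ops X Z"
proof -
  obtain C where C: "\<forall>x\<in>vectors X. vnorm Y (S x) \<le> C * vnorm X x"
    using S unfolding bounded_ops_def by blast
  obtain C' where C': "0 < C'" "\<forall>y\<in>vectors Y. vnorm Z (S' y) \<le> C' * vnorm Y y"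
    using bounded_ops_positive_bound[OF S' nonneg] by blast
  have "vnorm Z (S' (S x)) \<le> (C' * C) * vnorm X x" if "x \<in> vectors X" for x
  proof -
    have "vnorm Z (S' (S x)) \<le> C' * vnorm Y (S x)"
      using C'(2) bounded_ops_maps[OF S that] by blast
    also have "\<dots> \<le> C' * (C * vnorm X x)"
      using C that C'(1) by (intro mult_left_mono) auto
    finally show ?thesis by (simp add: mult.assoc)
  qed
  then show ?thesis
    using S S' unfolding bounded_ops_def by auto
qed

text \<open>
  Both operators act blockwise: \<open>B\<close> places the \<open>n\<close>-th block of \<open>x\<close> on the span of the \<open>f n i\<close> and
  \<open>A\<close> reads it off with the \<open>g n i\<close>. As the blocks are supported on disjoint intervals, the norm
  estimates of the blocks add up. The biorthogonality gives \<open>A R B x = x\<close> when \<open>B x\<close> is cut off after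
  finitely many blocks, and the continuity of \<open>R\<close> gives it in general.
\<close>

lemma formal_identity_factors:
  fixes R :: "(nat \<Rightarrow> 'k::{real_normed_field, euclidean_space}) \<Rightarrow> nat \<Rightarrow> 'k"
  assumes p: "1 < p" "p \<le> 2" and q: "2 \<le> q" and R: "R \<in> bounded_ops (ell p) (ell q)"
    and not_fss: "\<not> finitely_strictly_singular (ell p) (ell q) R"
  shows "\<exists>A\<in>bounded_ops (ell q) (ell2n_sum q). \<exists>B\<in>bounded_ops (ell2n_sum p) (ell p).
    \<forall>x\<in>vectors (ell2n_sum p). A (R (B x)) = formal_identity x"
proof -
  have p0: "0 < p" and q0: "0 < q" using p q by auto
  obtain c s f g where c: "0 < c" and s0: "s 0 = 0" and mono: "strict_mono s"
    and supp: "\<forall>n. \<forall>i<n. \<forall>j. j \<notin> {s n..<s (Suc n)} \<longrightarrow> f n i j = 0"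
    and biorth: "\<forall>n. \<forall>i<n. \<forall>m. \<forall>l<m. (\<Sum>j\<in>{s n..<s (Suc n)}. g n i j * R (f m l) j)
        = (if n = m \<and> i = l then 1 else 0)"
    and f_bound: "\<forall>n a. pnorm p (s (Suc n)) (\<Sum>i<n. fscale (a i) (f n i)) \<le> c * L2_set (\<lambda>i. norm (a i)) {..<n}"
    and g_bound: "\<forall>n y. L2_set (\<lambda>i. norm (\<Sum>j\<in>{s n..<s (Suc n)}. g n i j * y j)) {..<n} powr q
        \<le> (\<Sum>j\<in>{s n..<s (Suc n)}. norm (y j) powr q)"
    using hilbert_block_sequence[OF assms] by (elim exE conjE)
  let ?I = "\<lambda>n. {s n..<s (Suc n)}"
  have s_ge: "n \<le> s n" for n using mono by (rule strict_mono_imp_increasing)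
  define A where "A y = (\<lambda>(n, i). if i < n then \<Sum>j\<in>?I n. g n i j * y j else 0)" for y :: "nat \<Rightarrow> 'k"
  \<comment> \<open>The sum over all blocks is finite at every coordinate, as the \<open>n\<close>-th block starts at \<open>s n \<ge> n\<close>.\<close>
  define B where "B x j = (\<Sum>n\<le>j. \<Sum>i<n. x (n, i) * f n i j)" for x :: "nat \<times> nat \<Rightarrow> 'k" and j
  have vanish: "(\<Sum>i<m. x (m, i) * f m i j) = 0" if "j \<notin> ?I m" for x :: "nat \<times> nat \<Rightarrow> 'k" and m j
  proof -
    have "f m i j = 0" if "i < m" for i using supp that \<open>j \<notin> ?I m\<close> by blast
    then show ?thesis by simp
  qed
  have B_block: "B x j = (\<Sum>i<n. x (n, i) * f n i j)" if j: "j \<in> ?I n" for x j n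
  proof -
    have other: "(\<Sum>i<m. x (m, i) * f m i j) = 0" if "m \<noteq> n" for m
    proof -
      have "j \<notin> ?I m"
        using that j strict_mono_less_eq[OF mono, of "Suc m" n] strict_mono_less_eq[OF mono, of "Suc n" m]
        by (cases "m < n") auto
      then show ?thesis by (rule vanish)
    qed
    have "n \<le> j" using j s_ge[of n] by simp
    then have "B x j = (\<Sum>m\<le>j. if m = n then \<Sum>i<n. x (n, i) * f n i j else 0)"
      unfolding B_def using other by (intro sum.cong) auto
    then show ?thesis using \<open>n \<le> j\<close> by simp
  qed
  have B_partial: "(\<Sum>j<s M. norm (B x j) powr p) \<le> c powr p * (\<Sum>n<M. block_norm x n powr p)" for x M
  proof -
    have "(\<Sum>j\<in>?I n. norm (B x j) powr p) \<le> c powr p * block_norm x n powr p" for n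
    proof -
      let ?w = "\<Sum>i<n. fscale (x (n, i)) (f n i)"
      have "(\<Sum>j\<in>?I n. norm (B x j) powr p) = (\<Sum>j\<in>?I n. norm (?w j) powr p)"
        by (intro sum.cong) (simp_all add: B_block sum_fun_apply fscale_def)
      also have "\<dots> \<le> (\<Sum>j<s (Suc n). norm (?w j) powr p)"
        by (intro sum_mono2) auto
      also have "\<dots> = pnorm p (s (Suc n)) ?w powr p" by (rule pnorm_powr[OF p0, symmetric])
      also have "\<dots> \<le> (c * block_norm x n) powr p"
        using f_bound p0 unfolding block_norm_def by (intro powr_mono2) auto
      finally show ?thesis by (simp add: powr_mult)
    qed
    then show ?thesis unfolding sum_over_blocks[OF s0 mono] sum_distrib_left by (rule sum_mono)
  qed
  have x_summable: "summable (\<lambda>n. block_norm x n powr p)" if "x \<in> vectors (ell2n_sum p)" for x :: "nat \<times> nat \<Rightarrow> 'k"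
    using that by (simp add: ell2n_sum_def)
  have B_bound: "(\<Sum>j<M. norm (B x j) powr p) \<le> (c * vnorm (ell2n_sum p) x) powr p"
    if x: "x \<in> vectors (ell2n_sum p)" for x M
  proof -
    have "(\<Sum>j<M. norm (B x j) powr p) \<le> (\<Sum>j<s M. norm (B x j) powr p)"
      using s_ge[of M] by (intro sum_mono2) auto
    also have "\<dots> \<le> c powr p * (\<Sum>n<M. block_norm x n powr p)" by (rule B_partial)
    also have "\<dots> \<le> c powr p * (\<Sum>n. block_norm x n powr p)"
      using x_summable[OF x] by (intro mult_left_mono sum_le_suminf) auto
    finally show ?thesis using x p0 by (simp add: powr_mult vnorm_ell2n_sum_powr)
  qed
  have B_mem: "B x \<in> vectors (ell p)" if "x \<in> vectors (ell2n_sum p)" for x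
    unfolding ell_vectors_iff using B_bound[OF that]
    by (intro summableI_nonneg_bounded) auto
  have B_ops: "B \<in> bounded_ops (ell2n_sum p) (ell p)"
    unfolding bounded_ops_def
  proof (intro CollectI conjI ballI allI exI[of _ c])
    show "B (x + y) = B x + B y" for x y
      by (simp add: B_def fun_eq_iff distrib_right sum.distrib)
    show "B (fscale a x) = fscale a (B x)" for a x
      by (simp add: B_def fscale_def fun_eq_iff sum_distrib_left mult.assoc)
    fix x :: "nat \<times> nat \<Rightarrow> 'k" assume x: "x \<in> vectors (ell2n_sum p)"
    have "vnorm (ell p) (B x) powr p = (\<Sum>j. norm (B x j) powr p)"
      by (rule vnorm_ell_powr[OF p0 B_mem[OF x]])
    also have "\<dots> \<le> (c * vnorm (ell2n_sum p) x) powr p"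
      using B_mem[OF x] B_bound[OF x] by (intro suminf_le_const) (auto simp: ell_vectors_iff)
    finally show "vnorm (ell p) (B x) \<le> c * vnorm (ell2n_sum p) x"
      by (rule powr_le_cancel_base[OF p0, rotated]) (use c in simp)
  qed (rule B_mem)
  have A_block: "block_norm (A y) n powr q \<le> (\<Sum>j\<in>?I n. norm (y j) powr q)" for y n
  proof -
    have "block_norm (A y) n = L2_set (\<lambda>i. norm (\<Sum>j\<in>?I n. g n i j * y j)) {..<n}"
      unfolding block_norm_def by (intro L2_set_cong) (auto simp: A_def)
    then show ?thesis using g_bound by simp
  qed
  have A_bound: "(\<Sum>n<M. block_norm (A y) n powr q) \<le> vnorm (ell q) y powr q"
    if y: "y \<in> vectors (ell q)" for y M
  proof -
    have "(\<Sum>n<M. block_norm (A y) n powr q) \<le> (\<Sum>j<s M. norm (y j) powr q)"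
      unfolding sum_over_blocks[OF s0 mono] by (intro sum_mono A_block)
    also have "\<dots> \<le> (\<Sum>j. norm (y j) powr q)"
      using y by (intro sum_le_suminf) (auto simp: ell_vectors_iff)
    finally show ?thesis using y q0 by (simp add: vnorm_ell_powr)
  qed
  have A_mem: "A y \<in> vectors (ell2n_sum q)" if "y \<in> vectors (ell q)" for y
  proof -
    have "summable (\<lambda>n. block_norm (A y) n powr q)"
      using A_bound[OF that] by (intro summableI_nonneg_bounded) auto
    then show ?thesis by (simp add: ell2n_sum_def A_def)
  qed
  have A_ops: "A \<in> bounded_ops (ell q) (ell2n_sum q)"
    unfolding bounded_ops_def
  proof (intro CollectI conjI ballI allI exI[of _ 1])
    show "A (x + y) = A x + A y" for x y
      by (auto simp: A_def fun_eq_iff distrib_left sum.distrib)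
    show "A (fscale a x) = fscale a (A x)" for a x
      by (auto simp: A_def fscale_def fun_eq_iff sum_distrib_left mult_ac)
    fix y :: "nat \<Rightarrow> 'k" assume y: "y \<in> vectors (ell q)"
    have "vnorm (ell2n_sum q) (A y) powr q = (\<Sum>n. block_norm (A y) n powr q)"
      by (rule vnorm_ell2n_sum_powr[OF q0 A_mem[OF y]])
    also have "\<dots> \<le> vnorm (ell q) y powr q"
      using A_mem[OF y] A_bound[OF y] by (intro suminf_le_const) (auto simp: ell2n_sum_def)
    finally show "vnorm (ell2n_sum q) (A y) \<le> 1 * vnorm (ell q) y"
      using powr_le_cancel_base[OF q0, of "vnorm (ell q) y"] by simp
  qed (rule A_mem)
  have "A (R (B x)) (n, i) = x (n, i)" if x: "x \<in> vectors (ell2n_sum p)" for x n i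
  proof (cases "i < n")
    case False
    then show ?thesis using x by (simp add: A_def ell2n_sum_def)
  next
    case i: True
    define G where "G y = (\<Sum>j\<in>?I n. g n i j * y j)" for y
    have G_add: "G (y + z) = G y + G z" for y z
      by (simp add: G_def distrib_left sum.distrib)
    have G_sum: "G (\<Sum>a\<in>K. fscale (h a) (y a)) = (\<Sum>a\<in>K. h a * G (y a))"
      for K and h :: "nat \<times> nat \<Rightarrow> 'k" and y
      unfolding G_def sum_fun_apply fscale_def sum_distrib_left
      by (subst sum.swap) (simp add: mult_ac)
    have G_bound: "norm (G y) \<le> vnorm (ell q) y" if y: "y \<in> vectors (ell q)" for y
    proof (rule powr_le_cancel_base[OF q0 vnorm_ell_nonneg])
      have "norm (G y) \<le> L2_set (\<lambda>i. norm (\<Sum>j\<in>?I n. g n i j * y j)) {..<n}"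
        unfolding G_def using i by (intro member_le_L2_set) auto
      then have "norm (G y) powr q \<le> L2_set (\<lambda>i. norm (\<Sum>j\<in>?I n. g n i j * y j)) {..<n} powr q"
        using q0 by (intro powr_mono2) auto
      also have "\<dots> \<le> (\<Sum>j\<in>?I n. norm (y j) powr q)" using g_bound by blast
      also have "\<dots> \<le> (\<Sum>j. norm (y j) powr q)"
        using y by (intro sum_le_suminf) (auto simp: ell_vectors_iff)
      also have "\<dots> = vnorm (ell q) y powr q" by (rule vnorm_ell_powr[OF q0 y, symmetric])
      finally show "norm (G y) powr q \<le> vnorm (ell q) y powr q" .
    qed
    obtain C where C: "0 < C" "\<forall>x\<in>vectors (ell p). vnorm (ell q) (R x) \<le> C * vnorm (ell p) x"
      using bounded_ops_positive_bound[OF R] by auto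
    have f_mem: "f m l \<in> vectors (ell p)" if "l < m" for m l
      using supp that by (intro ell_vectors_finite_support[of "s (Suc m)"]) auto
    have G_f: "G (R (f m l)) = (if m = n \<and> l = i then 1 else 0)" if "l < m" for m l
      using biorth i that by (auto simp: G_def)
    have initial: "G (R (trunc (s M) (B x))) = x (n, i)" if M: "n < M" for M
    proof -
      let ?K = "SIGMA m:{..<M}. {..<m}"
      have "trunc (s M) (B x) = (\<Sum>a\<in>?K. fscale (x a) (f (fst a) (snd a)))"
      proof
        fix j
        have "(\<Sum>a\<in>?K. fscale (x a) (f (fst a) (snd a))) j = (\<Sum>m<M. \<Sum>l<m. x (m, l) * f m l j)"
          by (simp add: sum_fun_apply fscale_def sum.Sigma case_prod_beta)
        also have "\<dots> = trunc (s M) (B x) j"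
        proof (cases "j < s M")
          case True
          have "(\<Sum>m<M. \<Sum>l<m. x (m, l) * f m l j) = (\<Sum>m\<in>{..<M} \<inter> {..j}. \<Sum>l<m. x (m, l) * f m l j)"
          proof (intro sum.mono_neutral_right ballI vanish)
            fix m assume "m \<in> {..<M} - {..<M} \<inter> {..j}"
            then show "j \<notin> ?I m" using s_ge[of m] by auto
          qed auto
          also have "\<dots> = B x j"
            unfolding B_def
          proof (intro sum.mono_neutral_left ballI vanish)
            fix m assume "m \<in> {..j} - {..<M} \<inter> {..j}"
            then have "M \<le> m" by auto
            then have "s M \<le> s m" using mono by (simp add: strict_mono_less_eq)
            then show "j \<notin> ?I m" using True by simp
          qed auto
          finally show ?thesis using True by (simp add: trunc_def)
        next
          case False
          have "j \<notin> ?I m" if "m < M" for m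
            using strict_mono_less_eq[OF mono, of "Suc m" M] that False by simp
          then show ?thesis using False by (simp add: vanish trunc_def)
        qed
        finally show "trunc (s M) (B x) j = (\<Sum>a\<in>?K. fscale (x a) (f (fst a) (snd a))) j" by simp
      qed
      then have "R (trunc (s M) (B x)) = R (\<Sum>a\<in>?K. fscale (x a) (f (fst a) (snd a)))"
        by (rule arg_cong)
      also have "\<dots> = (\<Sum>a\<in>?K. fscale (x a) (R (f (fst a) (snd a))))"
        by (rule bounded_ops_ell_combination[OF p0 R]) (use f_mem in auto)
      finally have "G (R (trunc (s M) (B x))) = (\<Sum>a\<in>?K. x a * G (R (f (fst a) (snd a))))"
        by (simp only: G_sum)
      also have "\<dots> = (\<Sum>a\<in>?K. if a = (n, i) then x (n, i) else 0)"
        by (intro sum.cong) (auto simp: G_f split: if_splits)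
      also have "\<dots> = x (n, i)" using i M by simp
      finally show ?thesis .
    qed
    \<comment> \<open>The error comes from the tail of \<open>B x\<close> beyond any given block and is therefore arbitrarily small.\<close>
    define D where "D = norm (G (R (B x)) - x (n, i))"
    have D: "D powr p \<le> C powr p * vnorm (ell p) (cut_below (s M) (B x)) powr p" if "n < M" for M
    proof -
      let ?u = "trunc (s M) (B x)" and ?w = "cut_below (s M) (B x)"
      have w: "?w \<in> vectors (ell p)" using B_mem[OF x] by (rule ell_vectors_cut_below)
      have "R (B x) = R ?u + R ?w"
        using bounded_ops_add[OF R ell_vectors_trunc w, of "s M" "B x"] by (simp only: trunc_plus_cut_below)
      then have "D = norm (G (R ?w))" using initial[OF that] by (simp only: D_def G_add) simp
      also have "\<dots> \<le> vnorm (ell q) (R ?w)" by (intro G_bound bounded_ops_maps[OF R] w)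
      also have "\<dots> \<le> C * vnorm (ell p) ?w" using C(2) w by blast
      finally have "D \<le> C * vnorm (ell p) ?w" .
      then have "D powr p \<le> (C * vnorm (ell p) ?w) powr p"
        using p0 by (intro powr_mono2) (auto simp: D_def)
      then show ?thesis by (simp add: powr_mult)
    qed
    have "(\<lambda>M. vnorm (ell p) (cut_below (s M) (B x)) powr p) \<longlonglongrightarrow> 0"
      using LIMSEQ_subseq_LIMSEQ[OF ell_tail_tendsto[OF p0 B_mem[OF x]] mono] by (simp add: o_def)
    from tendsto_mult_left[OF this, of "C powr p"]
    have "D powr p \<le> C powr p * 0"
      by (rule LIMSEQ_le_const) (use D in \<open>auto intro!: exI[of _ "Suc n"]\<close>)
    then have "D = 0" by simp
    then show ?thesis using i by (simp add: D_def A_def G_def)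
  qed
  then have "A (R (B x)) = formal_identity x" if "x \<in> vectors (ell2n_sum p)" for x
    using that by (auto simp: formal_identity_def fun_eq_iff)
  then show ?thesis using A_ops B_ops by blast
qed

theorem theorem4p11:
  fixes p q :: real
    and R T :: "(nat \<Rightarrow> 'k::{real_normed_field, euclidean_space}) \<Rightarrow> nat \<Rightarrow> 'k"
  assumes "1 < p" and "p \<le> 2" and "2 \<le> q" and "p < q"
    and "R \<in> bounded_ops (ell p) (ell q)"
    and "\<not> finitely_strictly_singular (ell p) (ell q) R"
    and "pelczynski_decomposition_operator p q T"
  shows "\<exists>A \<in> bounded_ops (ell q) (ell q). \<exists>B \<in> bounded_ops (ell p) (ell p).
           \<forall>x\<in>vectors (ell p). T x = A (R (B x))"
proof -
  obtain U V where U: "U \<in> isomorphisms (ell p) (ell2n_sum p)"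
    and V: "V \<in> isomorphisms (ell2n_sum q) (ell q)"
    and T: "\<forall>x\<in>vectors (ell p). T x = V (formal_identity (U x))"
    using assms(7) unfolding pelczynski_decomposition_operator_def by blast
  have U_ops: "U \<in> bounded_ops (ell p) (ell2n_sum p)" and V_ops: "V \<in> bounded_ops (ell2n_sum q) (ell q)"
    using U V by (simp_all add: isomorphisms_def)
  obtain A B where A: "A \<in> bounded_ops (ell q) (ell2n_sum q)" and B: "B \<in> bounded_ops (ell2n_sum p) (ell p)"
    and factor: "\<forall>x\<in>vectors (ell2n_sum p). A (R (B x)) = formal_identity x"
    using formal_identity_factors[OF assms(1,2,3,5,6)] by blast
  show ?thesis
  proof (rule bexI[of _ "\<lambda>y. V (A y)"], rule bexI[of _ "\<lambda>x. B (U x)"], rule ballI)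
    show "T x = V (A (R (B (U x))))" if "x \<in> vectors (ell p)" for x
      using T that factor bounded_ops_maps[OF U_ops that] by simp
    show "(\<lambda>x. B (U x)) \<in> bounded_ops (ell p) (ell p)"
      by (rule bounded_ops_compose[OF U_ops B]) simp
    show "(\<lambda>y. V (A y)) \<in> bounded_ops (ell q) (ell q)"
      by (rule bounded_ops_compose[OF A V_ops]) simp
  qed
qed

end
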